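(* Fix a nonnegative integer $b$ and a rational number $c\in(b,\infty)$. Let $m=m(N)$ satisfy $m(N)\to\infty$ and $m(N)^2/N\to0$ as $N\to\infty$. The following conclusions hold. (a) Let $\theta\in\mathcal P_{\mathbb N_b,c}$ and $r>0$. Then for the open ball $B_\pi(\theta,r)$ in $\mathcal P_{\mathbb N_b,c}$, $R(B_\pi(\theta,r)|\rho_{b,\alpha_b(c)})$ is finite, and $$\lim_{N\to\infty}\frac1N\log P_{N,b,m}(\Theta_{N,b}\in B_\pi(\theta,r))=-R(B_\pi(\theta,r)|\rho_{b,\alpha_b(c)}).$$ (b) Let $\theta\in\mathcal P_{\mathbb N_b,[b,c]}$ and $r>0$. Then the set $\widehat B_\pi(\theta,r)\cap\mathcal P_{\mathbb N_b,c}$ is nonempty, $R(\widehat B_\pi(\theta,r)\cap\mathcal P_{\mathbb N_b,c}|\rho_{b,\alpha_b(c)})$ is finite, and $$\lim_{N\to\infty}\frac1N\log P_{N,b,m}(\Theta_{N,b}\in\widehat B_\pi(\theta,r)\cap\mathcal P_{\mathbb N_b,c})=-R(\widehat B_\pi(\theta,r)\cap\mathcal P_{\mathbb N_b,c}|\rho_{b,\alpha_b(c)}).$$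
   Context: Notation: $\mathbb N_b=\{n\in\mathbb Z:n\ge b\}$. $N$ ranges only over integers $N\ge2$ for which $K:=cN$ is an integer, and limits $N\to\infty$ are along such $N$. $m=m(N)$ is an integer with $2\le m(N)\le N$. Model: $\Lambda_N=\{1,\dots,N\}$ and $\Omega_N=\Lambda_N^K$ is the set of $\omega=(\omega_1,\dots,\omega_K)$. For $\ell\in\Lambda_N$, $K_\ell(\omega)=\mathrm{card}\{i:\omega_i=\ell\}$; for integers $j\ge0$, $N_j(\omega)=\mathrm{card}\{\ell\in\Lambda_N:K_\ell(\omega)=j\}$; $|N(\omega)|_+=\mathrm{card}\{j\in\mathbb N_b:N_j(\omega)\ge1\}$. Set $\Omega_{N,b,m}=\{\omega\in\Omega_N:K_\ell(\omega)\ge b\ \forall\ell\in\Lambda_N,\ |N(\omega)|_+\le m(N)\}$, and let $P_{N,b,m}$ be the uniform probability measure on $\Omega_{N,b,m}$. The number-density measure $\Theta_{N,b}(\omega)$, $\omega\in\Omega_{N,b,m}$, is the probability measure on $\mathbb N_b$ giving mass $N_j(\omega)/N$ to each $j\in\mathbb N_b$; it has mean $c$. $\mathcal P_{\mathbb N_b}$ is the set of probability measures on $\mathbb N_b$ with the topology of weak convergence, metrized by the Prohorov metric $\pi$ (built from $d(x,y)=|x-y|$); $\mathcal P_{\mathbb N_b,c}$ and $\mathcal P_{\mathbb N_b,[b,c]}$ are the subsets of measures with mean $c$, respectively mean in $[b,c]$. $B_\pi(\theta,r)=\{\mu\in\mathcal P_{\mathbb N_b,c}:\pi(\theta,\mu)<r\}$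 and $\widehat B_\pi(\theta,r)=\{\mu\in\mathcal P_{\mathbb N_b,[b,c]}:\pi(\theta,\mu)<r\}$. For $\alpha>0$, $\rho_{b,\alpha}$ is the probability measure on $\mathbb N_b$ with $\rho_{b,\alpha;j}=\frac{1}{Z_b(\alpha)}\frac{\alpha^j}{j!}$, where $Z_0(\alpha)=e^\alpha$ and $Z_b(\alpha)=e^\alpha-\sum_{j=0}^{b-1}\alpha^j/j!$ for $b\ge1$. $\alpha_b(c)$ is the unique $\alpha\in(0,\infty)$ for which $\rho_{b,\alpha}$ has mean $c$. $R(\theta|\rho)=\sum_{j\in\mathbb N_b}\theta_j\log(\theta_j/\rho_j)$ with $0\log0=0$, and $R(A|\rho)=\inf_{\theta\in A}R(\theta|\rho)$ for a set $A$. *)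

theory Defs
  imports "HOL-Probability.Probability"
begin

text \<open>A probability measure on the discrete space of all integers at least \<open>b\<close> is represented by
  a \<open>nat pmf\<close> whose support lies in \<open>{b..}\<close>.\<close>

definition prob_measures :: "nat \<Rightarrow> nat pmf set" where
  "prob_measures b = {\<mu>. set_pmf \<mu> \<subseteq> {b..}}"

text \<open>Integrability has to be demanded explicitly, since the Bochner integral of a
  non-integrable function is \<open>0\<close>.\<close>

definition has_mean :: "nat pmf \<Rightarrow> real \<Rightarrow> bool" where
  "has_mean \<mu> x \<longleftrightarrow>
     integrable (measure_pmf \<mu>) real \<and> measure_pmf.expectation \<mu> real = x"

definition prob_measures_mean :: "nat \<Rightarrow> real \<Rightarrow> nat pmf set" where
  "prob_measures_mean b c = {\<mu> \<in> prob_measures b. has_mean \<mu> c}"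

definition prob_measures_mean_le :: "nat \<Rightarrow> real \<Rightarrow> nat pmf set" where
  "prob_measures_mean_le b c = {\<mu> \<in> prob_measures b. \<exists>x\<in>{real b..c}. has_mean \<mu> x}"

text \<open>All subsets of \<open>{b..}\<close> are Borel (and closed), so \<open>A\<close> ranges over all of them.\<close>

definition prohorov :: "nat \<Rightarrow> nat pmf \<Rightarrow> nat pmf \<Rightarrow> real" where
  "prohorov b \<mu> \<nu> = Inf {\<epsilon>. \<epsilon> > 0 \<and> (\<forall>A\<subseteq>{b..}.
     let A\<epsilon> = {x\<in>{b..}. \<exists>a\<in>A. dist x a < \<epsilon>} in
       measure_pmf.prob \<mu> A \<le> measure_pmf.prob \<nu> A\<epsilon> + \<epsilon> \<and>
       measure_pmf.prob \<nu> A \<le> measure_pmf.prob \<mu> A\<epsilon> + \<epsilon>)}"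

definition ball_mean :: "nat \<Rightarrow> real \<Rightarrow> nat pmf \<Rightarrow> real \<Rightarrow> nat pmf set" where
  "ball_mean b c \<theta> r = {\<mu> \<in> prob_measures_mean b c. prohorov b \<theta> \<mu> < r}"

definition ball_mean_le :: "nat \<Rightarrow> real \<Rightarrow> nat pmf \<Rightarrow> real \<Rightarrow> nat pmf set" where
  "ball_mean_le b c \<theta> r = {\<mu> \<in> prob_measures_mean_le b c. prohorov b \<theta> \<mu> < r}"

definition Zb :: "nat \<Rightarrow> real \<Rightarrow> real" where
  "Zb b \<alpha> = exp \<alpha> - (\<Sum>j<b. \<alpha> ^ j / fact j)"

text \<open>The argument of \<open>embed_pmf\<close> is a probability mass function for \<open>\<alpha> > 0\<close>; see
  \<open>pmf_rho\<close> below.\<close>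

definition rho :: "nat \<Rightarrow> real \<Rightarrow> nat pmf" where
  "rho b \<alpha> = embed_pmf (\<lambda>j. if b \<le> j then (\<alpha> ^ j / fact j) / Zb b \<alpha> else 0)"

definition alpha :: "nat \<Rightarrow> real \<Rightarrow> real" where
  "alpha b c = (THE \<alpha>. \<alpha> > 0 \<and> has_mean (rho b \<alpha>) c)"

text \<open>The relative entropy of \<open>\<theta>\<close> with respect to a \<open>\<rho>\<close> that charges every point of
  \<open>{b..}\<close>, as an extended real. The convention \<open>0 log 0 = 0\<close> is automatic. The negative parts
  of the summands are at most \<open>\<rho>\<^sub>j / e\<close>, hence the partial sums always converge in
  \<open>(-\<infinity>, \<infinity>]\<close> and the limit does not depend on the order of summation.\<close>

definition rel_entropy :: "nat \<Rightarrow> nat pmf \<Rightarrow> nat pmf \<Rightarrow> ereal" where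
  "rel_entropy b \<theta> \<rho> =
     (\<Sum>i. ereal (pmf \<theta> (b + i) * ln (pmf \<theta> (b + i) / pmf \<rho> (b + i))))"

definition rel_entropy_set :: "nat \<Rightarrow> nat pmf set \<Rightarrow> nat pmf \<Rightarrow> ereal" where
  "rel_entropy_set b A \<rho> = (INF \<theta>\<in>A. rel_entropy b \<theta> \<rho>)"

definition configs :: "nat \<Rightarrow> nat \<Rightarrow> (nat \<Rightarrow> nat) set" where
  "configs N K = {1..K} \<rightarrow>\<^sub>E {1..N}"

definition occ :: "nat \<Rightarrow> (nat \<Rightarrow> nat) \<Rightarrow> nat \<Rightarrow> nat" where
  "occ K \<omega> l = card {i\<in>{1..K}. \<omega> i = l}"

definition num_sites :: "nat \<Rightarrow> nat \<Rightarrow> (nat \<Rightarrow> nat) \<Rightarrow> nat \<Rightarrow> nat" where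
  "num_sites N K \<omega> j = card {l\<in>{1..N}. occ K \<omega> l = j}"

definition num_pos :: "nat \<Rightarrow> nat \<Rightarrow> nat \<Rightarrow> (nat \<Rightarrow> nat) \<Rightarrow> nat" where
  "num_pos b N K \<omega> = card {j\<in>{b..}. num_sites N K \<omega> j \<ge> 1}"

text \<open>\<open>M\<close> is the bound \<open>m(N)\<close>.\<close>

definition Omega :: "nat \<Rightarrow> nat \<Rightarrow> nat \<Rightarrow> nat \<Rightarrow> (nat \<Rightarrow> nat) set" where
  "Omega b N K M =
     {\<omega> \<in> configs N K. (\<forall>l\<in>{1..N}. b \<le> occ K \<omega> l) \<and> num_pos b N K \<omega> \<le> M}"

text \<open>On \<open>Omega b N K M\<close> with \<open>N > 0\<close> the argument of \<open>embed_pmf\<close> is a probability mass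
  function; see \<open>pmf_Theta\<close> below.\<close>

definition Theta :: "nat \<Rightarrow> nat \<Rightarrow> nat \<Rightarrow> (nat \<Rightarrow> nat) \<Rightarrow> nat pmf" where
  "Theta b N K \<omega> =
     embed_pmf (\<lambda>j. if b \<le> j then real (num_sites N K \<omega> j) / real N else 0)"

text \<open>The number \<open>K = c N\<close> is an integer for the admissible \<open>N\<close>. The probability space is
  non-empty for these \<open>N\<close> if \<open>b < c\<close> and \<open>m N \<ge> 2\<close>, which \<open>pmf_of_set\<close> requires.\<close>

definition num_particles :: "real \<Rightarrow> nat \<Rightarrow> nat" where
  "num_particles c N = nat \<lfloor>c * real N\<rfloor>"

definition prob_Theta :: "nat \<Rightarrow> real \<Rightarrow> (nat \<Rightarrow> nat) \<Rightarrow> nat \<Rightarrow> nat pmf set \<Rightarrow> real" where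
  "prob_Theta b c m N B =
     (let K = num_particles c N in
      measure_pmf.prob (pmf_of_set (Omega b N K (m N))) {\<omega>. Theta b N K \<omega> \<in> B})"

definition admissible :: "real \<Rightarrow> nat set" where
  "admissible c = {N. 2 \<le> N \<and> c * real N \<in> \<int>}"

definition along :: "real \<Rightarrow> nat filter" where
  "along c = inf sequentially (principal (admissible c))"

text \<open>The logarithm of a probability, with \<open>log 0 = -\<infinity>\<close> (whereas \<open>ln 0 = 0\<close> for reals).\<close>

definition eln :: "real \<Rightarrow> ereal" where
  "eln p = (if p > 0 then ereal (ln p) else -\<infinity>)"

lemma Zb_sums:
  "(\<lambda>i. \<alpha> ^ (i + b) / fact (i + b)) sums Zb b \<alpha>"
proof -
  have "(\<lambda>n. \<alpha> ^ n / fact n) sums exp \<alpha>"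
    using exp_converges[of \<alpha>] by (simp add: field_simps)
  from sums_split_initial_segment[OF this, of b] show ?thesis
    by (simp add: Zb_def)
qed

lemma Zb_pos: "Zb b \<alpha> > 0" if "\<alpha> > 0"
  using suminf_pos[OF sums_summable[OF Zb_sums]] sums_unique[OF Zb_sums] that
  by (metis divide_pos_pos fact_gt_zero zero_less_power)

lemma pmf_rho:
  assumes "\<alpha> > 0"
  shows "pmf (rho b \<alpha>) j = (if b \<le> j then (\<alpha> ^ j / fact j) / Zb b \<alpha> else 0)"
proof -
  define f where "f j = (if b \<le> j then (\<alpha> ^ j / fact j) / Zb b \<alpha> else 0)" for j
  have nn: "f j \<ge> 0" for j
    using assms Zb_pos[OF assms, of b] by (simp add: f_def)
  have "(\<lambda>i. f (i + b)) sums (Zb b \<alpha> / Zb b \<alpha>)"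
    using sums_divide[OF Zb_sums, of \<alpha> b "Zb b \<alpha>"] by (simp add: f_def)
  then have "f sums 1"
    using Zb_pos[OF assms, of b] by (subst (asm) sums_iff_shift) (simp add: f_def)
  then have "(\<integral>\<^sup>+ x. ennreal (f x) \<partial>count_space UNIV) = 1"
    using nn by (simp add: nn_integral_count_space_nat suminf_ennreal_eq sums_unique[symmetric])
  then show ?thesis
    using pmf_embed_pmf[of f j] nn by (simp add: rho_def f_def[abs_def])
qed

lemma pmf_Theta:
  assumes "\<omega> \<in> Omega b N K M" "N > 0"
  shows "pmf (Theta b N K \<omega>) j = (if b \<le> j then real (num_sites N K \<omega> j) / real N else 0)"
proof -
  let ?f = "\<lambda>j. if b \<le> j then real (num_sites N K \<omega> j) / real N else 0"
  let ?e = "map_pmf (occ K \<omega>) (pmf_of_set {1..N})"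
  have eq: "?f j = pmf ?e j" for j
  proof -
    have "pmf ?e j = real (num_sites N K \<omega> j) / real N"
      using assms(2)
      by (simp add: pmf_map measure_pmf_of_set num_sites_def Int_def vimage_def conj_commute)
    moreover have "num_sites N K \<omega> j = 0" if "\<not> b \<le> j"
      using assms(1) that by (auto simp: num_sites_def Omega_def)
    ultimately show ?thesis by auto
  qed
  have "(\<integral>\<^sup>+ x. ennreal (?f x) \<partial>count_space UNIV) = 1"
    unfolding eq by (simp add: nn_integral_pmf)
  then show ?thesis
    using pmf_embed_pmf[of ?f j] by (simp add: Theta_def)
qed

end

theory Submission
  imports Defs "HOL-Combinatorics.Multiset_Permutations" "HOL-Real_Asymp.Real_Asymp"
begin

text \<open>
  The value of \<open>\<Theta>\<close> is determined by the type of \<open>\<omega>\<close>, the multiset \<open>T\<close> of the occupation numbers. The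
  number of configurations of type \<open>T\<close> is \<open>N! K! / (\<Prod>\<^sub>j N\<^sub>j! \<cdot> \<Prod>\<^sub>j (j!)^N\<^sub>j)\<close>, which by Stirling's bounds is
  \<open>exp (D\<^sub>N - N R(\<Theta>|\<rho>))\<close> up to a factor \<open>exp (O(m log N))\<close>, with \<open>D\<^sub>N\<close> independent of \<open>T\<close>. There are at
  most \<open>((K + 1) (N + 1))^m\<close> types, and \<open>m log N = o(N)\<close>. Hence \<open>log P(\<Theta> \<in> A) / N\<close> differs by \<open>o(1)\<close>
  from the minimum of \<open>R(\<cdot>|\<rho>)\<close> over all types less its minimum over the types in \<open>A\<close>. Types have
  mean \<open>c\<close>, so the latter is at least \<open>R(A|\<rho>)\<close>; conversely, for open \<open>A\<close> every measure in \<open>A\<close> of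
  finite entropy is approximated, in total variation and in entropy, first by a finitely supported
  measure with mean \<open>c\<close> and then by types. The supports of these types stay in a fixed finite set, so
  they are admitted as soon as \<open>m\<close> is large. Applied to \<open>\<rho>\<close> itself, the same approximation shows
  that the minimum over all types tends to \<open>R(\<rho>|\<rho>) = 0\<close>. The set in (b) is a ball of the same kind
  whose centre may have a smaller mean.
\<close>

section \<open>Counting configurations of a given type\<close>

lemma count_image_mset_set:
  "finite A \<Longrightarrow> count (image_mset f (mset_set A)) y = card {x \<in> A. f x = y}"
  by (simp add: count_image_mset' eq_commute)

text \<open>A function on the index set is the list of its values, and a prescribed value multiset
  makes that list a permutation of \<open>M\<close>; indices start at 1 and list positions at 0,
  whence \<open>i - 1\<close>. It serves twice: for placing particles on sites and for distributing
  occupation numbers over sites.\<close>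

lemma card_funcs_image_mset:
  assumes "size M = n" "set_mset M \<subseteq> S"
  shows "card {f \<in> {1..n} \<rightarrow>\<^sub>E S. image_mset f (mset_set {1..n}) = M} =
         card (permutations_of_multiset M)"
proof (rule bij_betw_same_card)
  have mset_map_upt: "mset (map f [1..<Suc n]) = image_mset f (mset_set {1..n})" for f :: "nat \<Rightarrow> 'a"
    by (metis atLeastLessThanSuc_atLeastAtMost mset_map mset_upt)
  have nth_map_upt: "map (\<lambda>i\<in>{1..n}. xs ! (i - 1)) [1..<Suc n] = xs" if "length xs = n" for xs :: "'a list"
    using that by (intro nth_equalityI) (auto simp del: upt_Suc)
  show "bij_betw (\<lambda>f. map f [1..<Suc n])
      {f \<in> {1..n} \<rightarrow>\<^sub>E S. image_mset f (mset_set {1..n}) = M} (permutations_of_multiset M)"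
  proof (rule bij_betw_byWitness[where f' = "\<lambda>xs. \<lambda>i\<in>{1..n}. xs ! (i - 1)"])
    show "\<forall>f\<in>{f \<in> {1..n} \<rightarrow>\<^sub>E S. image_mset f (mset_set {1..n}) = M}.
        (\<lambda>i\<in>{1..n}. map f [1..<Suc n] ! (i - 1)) = f"
    proof
      fix f assume "f \<in> {f \<in> {1..n} \<rightarrow>\<^sub>E S. image_mset f (mset_set {1..n}) = M}"
      then have f: "f \<in> extensional {1..n}" by (auto simp: PiE_def)
      show "(\<lambda>i\<in>{1..n}. map f [1..<Suc n] ! (i - 1)) = f"
        by (rule extensionalityI[OF _ f]) (auto simp del: upt_Suc)
    qed
    have len: "length xs = n" if "xs \<in> permutations_of_multiset M" for xs
      using that assms(1) by (auto simp: permutations_of_multiset_def)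
    show "\<forall>xs\<in>permutations_of_multiset M. map (\<lambda>i\<in>{1..n}. xs ! (i - 1)) [1..<Suc n] = xs"
      using nth_map_upt len by blast
    show "(\<lambda>f. map f [1..<Suc n]) ` {f \<in> {1..n} \<rightarrow>\<^sub>E S. image_mset f (mset_set {1..n}) = M}
        \<subseteq> permutations_of_multiset M"
      using mset_map_upt by (auto simp: permutations_of_multiset_def simp del: upt_Suc)
    show "(\<lambda>xs. \<lambda>i\<in>{1..n}. xs ! (i - 1)) ` permutations_of_multiset M
        \<subseteq> {f \<in> {1..n} \<rightarrow>\<^sub>E S. image_mset f (mset_set {1..n}) = M}"
    proof (intro image_subsetI CollectI conjI)
      fix xs assume xs: "xs \<in> permutations_of_multiset M"
      then have m: "mset xs = M" by (simp add: permutations_of_multiset_def)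
      show "(\<lambda>i\<in>{1..n}. xs ! (i - 1)) \<in> {1..n} \<rightarrow>\<^sub>E S"
      proof (intro restrict_PiE_iff[THEN iffD2] ballI)
        fix i assume "i \<in> {1..n}"
        then have "xs ! (i - 1) \<in> set xs" using len[OF xs] by (intro nth_mem) auto
        then show "xs ! (i - 1) \<in> S" using m assms(2) by auto
      qed
      show "image_mset (\<lambda>i\<in>{1..n}. xs ! (i - 1)) (mset_set {1..n}) = M"
        using mset_map_upt[of "\<lambda>i\<in>{1..n}. xs ! (i - 1)"] nth_map_upt[OF len[OF xs]] m by metis
    qed
  qed
qed

definition type_mset :: "nat \<Rightarrow> nat \<Rightarrow> (nat \<Rightarrow> nat) \<Rightarrow> nat multiset" where
  "type_mset N K \<omega> = image_mset (occ K \<omega>) (mset_set {1..N})"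

definition type_fiber :: "nat \<Rightarrow> nat \<Rightarrow> nat multiset \<Rightarrow> (nat \<Rightarrow> nat) set" where
  "type_fiber N K T = {\<omega> \<in> configs N K. type_mset N K \<omega> = T}"

lemma finite_configs: "finite (configs N K)"
  by (simp add: configs_def finite_PiE)

lemma finite_type_fiber: "finite (type_fiber N K T)"
  by (simp add: type_fiber_def finite_configs)

lemma count_type_mset: "count (type_mset N K \<omega>) j = num_sites N K \<omega> j"
  by (simp add: type_mset_def num_sites_def count_image_mset_set)

lemma occ_eq_count: "occ K \<omega> l = count (image_mset \<omega> (mset_set {1..K})) l"
  by (simp add: occ_def count_image_mset_set)

lemma size_type_mset: "size (type_mset N K \<omega>) = N"
  by (simp add: type_mset_def)

lemma sum_occ: "\<omega> \<in> configs N K \<Longrightarrow> (\<Sum>l\<in>{1..N}. occ K \<omega> l) = K"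
  using sum.group[of "{1..K}" "{1..N}" \<omega> "\<lambda>_. 1 :: nat"]
  by (auto simp: configs_def occ_def PiE_iff image_subset_iff)

lemma sum_mset_type_mset: "\<omega> \<in> configs N K \<Longrightarrow> sum_mset (type_mset N K \<omega>) = K"
  using sum_occ by (simp add: type_mset_def sum_unfold_sum_mset)

text \<open>A multinomial coefficient, with the denominator multiplied out to stay in the natural
  numbers: such configurations are the arrangements of the multiset \<open>M\<close> that holds site
  \<open>l\<close> with multiplicity \<open>k l\<close>.\<close>

lemma card_occ_class:
  assumes "(\<Sum>l\<in>{1..N}. k l) = K"
  shows "card {\<omega> \<in> configs N K. \<forall>l\<in>{1..N}. occ K \<omega> l = k l} * (\<Prod>l\<in>{1..N}. fact (k l)) = fact K"
proof -
  define M where "M = (\<Sum>l\<in>{1..N}. replicate_mset (k l) l)"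
  have cnt: "count M l = (if l \<in> {1..N} then k l else 0)" for l
    by (auto simp: M_def count_sum)
  have sz: "size M = K" using assms by (simp add: M_def size_multiset_sum)
  have sub: "set_mset M \<subseteq> {1..N}"
    using cnt by (metis count_eq_zero_iff subsetI)
  have "{\<omega> \<in> configs N K. \<forall>l\<in>{1..N}. occ K \<omega> l = k l} =
        {f \<in> {1..K} \<rightarrow>\<^sub>E {1..N}. image_mset f (mset_set {1..K}) = M}"
  proof (intro Collect_cong conj_cong)
    fix \<omega> assume w: "\<omega> \<in> {1..K} \<rightarrow>\<^sub>E {1..N}"
    then have "count (image_mset \<omega> (mset_set {1..K})) l = 0" if "l \<notin> {1..N}" for l
      using that by (auto simp: count_image_mset_set PiE_iff)
    then show "(\<forall>l\<in>{1..N}. occ K \<omega> l = k l) \<longleftrightarrow> image_mset \<omega> (mset_set {1..K}) = M"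
      by (auto simp: multiset_eq_iff occ_eq_count cnt)
  qed (simp add: configs_def)
  then have "card {\<omega> \<in> configs N K. \<forall>l\<in>{1..N}. occ K \<omega> l = k l} = card (permutations_of_multiset M)"
    using card_funcs_image_mset[OF sz sub] by simp
  \<comment> \<open>Sites with \<open>k l = 0\<close> are missing from \<open>set_mset M\<close>,
    but they contribute \<open>fact 0 = 1\<close>.\<close>
  moreover have "(\<Prod>l\<in>{1..N}. fact (k l)) = (\<Prod>l\<in>set_mset M. fact (count M l) :: nat)"
    by (rule prod.mono_neutral_cong_right)
      (use sub cnt in \<open>auto simp: count_eq_zero_iff[symmetric] simp del: count_eq_zero_iff\<close>)
  ultimately show ?thesis
    using card_permutations_of_multiset_aux[of M] sz by simp
qed

text \<open>A configuration of type \<open>T\<close> arises from two choices: an assignment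
  \<open>k\<close> of the occupation numbers to the sites, which is an arrangement of
  \<open>T\<close>, and then a placement of the particles that realizes \<open>k\<close>.\<close>

lemma card_type_fiber:
  assumes sz: "size T = N" and sm: "sum_mset T = K"
  shows "card (type_fiber N K T) * ((\<Prod>j\<in>set_mset T. fact (count T j)) * prod_mset (image_mset fact T))
    = fact N * fact K"
proof -
  define Ks where "Ks = {k \<in> {1..N} \<rightarrow>\<^sub>E set_mset T. image_mset k (mset_set {1..N}) = T}"
  define F where "F k = {\<omega> \<in> configs N K. \<forall>l\<in>{1..N}. occ K \<omega> l = k l}" for k
  have fin: "finite Ks" by (simp add: Ks_def finite_PiE)
  have un: "type_fiber N K T = (\<Union>k\<in>Ks. F k)"
  proof (intro set_eqI iffI)
    fix \<omega> assume w: "\<omega> \<in> type_fiber N K T"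
    define k where "k = restrict (occ K \<omega>) {1..N}"
    have "image_mset k (mset_set {1..N}) = T"
      using w by (auto simp: type_fiber_def type_mset_def k_def intro!: image_mset_cong)
    moreover from this have "k \<in> {1..N} \<rightarrow>\<^sub>E set_mset T"
      by (auto simp: k_def restrict_def)
    ultimately have "k \<in> Ks" by (simp add: Ks_def)
    moreover have "\<omega> \<in> F k" using w by (simp add: F_def k_def type_fiber_def)
    ultimately show "\<omega> \<in> (\<Union>k\<in>Ks. F k)" by blast
  next
    fix \<omega> assume "\<omega> \<in> (\<Union>k\<in>Ks. F k)"
    then obtain k where k: "k \<in> Ks" "\<omega> \<in> F k" by blast
    then have "image_mset (occ K \<omega>) (mset_set {1..N}) = image_mset k (mset_set {1..N})"
      by (intro image_mset_cong) (auto simp: F_def)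
    then show "\<omega> \<in> type_fiber N K T"
      using k by (simp add: type_fiber_def type_mset_def Ks_def F_def)
  qed
  have disj: "F k \<inter> F k' = {}" if "k \<in> Ks" "k' \<in> Ks" "k \<noteq> k'" for k k'
  proof -
    have "\<exists>l\<in>{1..N}. k l \<noteq> k' l"
      using that by (metis (no_types, lifting) Ks_def PiE_ext mem_Collect_eq)
    then show ?thesis by (auto simp: F_def)
  qed
  \<comment> \<open>The product of the factorials \<open>fact (k l)\<close> is the same for every
    arrangement \<open>k\<close> of \<open>T\<close>, so all classes \<open>F k\<close> have equal
    size.\<close>
  have cF: "card (F k) * prod_mset (image_mset fact T) = fact K" if "k \<in> Ks" for k
  proof -
    have k: "image_mset k (mset_set {1..N}) = T" using that by (simp add: Ks_def)
    then have "(\<Sum>l\<in>{1..N}. k l) = K" using sm by (auto simp: sum_unfold_sum_mset)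
    moreover have "prod_mset (image_mset fact T) = (\<Prod>l\<in>{1..N}. fact (k l) :: nat)"
      unfolding k[symmetric] by (simp add: prod_unfold_prod_mset comp_def multiset.map_comp)
    ultimately show ?thesis using card_occ_class[of k N K] by (simp add: F_def)
  qed
  have "card (type_fiber N K T) * prod_mset (image_mset fact T) = (\<Sum>k\<in>Ks. card (F k)) * prod_mset (image_mset fact T)"
    unfolding un by (subst card_UN_disjoint)
      (use fin disj finite_configs[of N K] in \<open>auto simp: F_def\<close>)
  also have "\<dots> = card Ks * fact K"
    by (simp add: sum_distrib_right cF)
  finally have 1: "card (type_fiber N K T) * prod_mset (image_mset fact T) = card Ks * fact K" .
  have "card Ks * (\<Prod>j\<in>set_mset T. fact (count T j)) = fact N"
    using card_funcs_image_mset[OF sz subset_refl] card_permutations_of_multiset_aux[of T] sz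
    by (simp add: Ks_def)
  with 1 show ?thesis by (metis (no_types, lifting) mult.assoc mult.commute)
qed

section \<open>Elementary Stirling bounds\<close>

lemma ln_fact_ge: "real n * ln (real n) - real n \<le> ln (fact n)"
proof (induction n)
  case (Suc n)
  show ?case
  proof (cases "n = 0")
    case False
    have "ln (real (Suc n)) - ln (real n) \<le> 1 / real n"
      using ln_diff_le[of "real (Suc n)" "real n"] False by (simp add: field_simps)
    then have "real n * (ln (real (Suc n)) - ln (real n)) \<le> 1"
      using False by (simp add: field_simps)
    moreover have "ln (fact (Suc n)) = ln (real (Suc n)) + ln (fact n)"
      by (simp add: ln_mult)
    ultimately show ?thesis using Suc.IH by (simp add: algebra_simps)
  qed simp
qed simp

text \<open>Like the lower bound, an induction that compares \<open>ln (n + 1) - ln n\<close> with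
  an adjacent reciprocal. The surplus \<open>ln n + 1\<close> is coarser than Stirling's formula,
  but it is paid only once per occupation number that occurs, hence at most \<open>m N\<close>
  times.\<close>

lemma ln_fact_le:
  assumes "n \<ge> 1"
  shows "ln (fact n) \<le> real n * ln (real n) - real n + ln (real n) + 1"
  using assms
proof (induction n rule: dec_induct)
  case (step n)
  have "ln (real n) - ln (real (Suc n)) \<le> - 1 / real (Suc n)"
    using ln_diff_le[of "real n" "real (Suc n)"] step.hyps by (simp add: field_simps)
  then have "1 \<le> real (Suc n) * (ln (real (Suc n)) - ln (real n))"
    by (simp add: field_simps)
  moreover have "ln (fact (Suc n)) = ln (real (Suc n)) + ln (fact n)"
    by (simp add: ln_mult)
  ultimately show ?case using step.IH by (simp add: algebra_simps)
qed simp

section \<open>Relative entropy\<close>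

lemma integrable_measure_pmf_nat_iff:
  fixes f :: "nat \<Rightarrow> real"
  shows "integrable (measure_pmf \<mu>) f \<longleftrightarrow> summable (\<lambda>j. norm (pmf \<mu> j * f j))"
  by (simp add: measure_pmf_eq_density integrable_density integrable_count_space_nat_iff)

lemma sums_expectation_pmf_nat:
  fixes f :: "nat \<Rightarrow> real"
  assumes "integrable (measure_pmf \<mu>) f"
  shows "(\<lambda>j. pmf \<mu> j * f j) sums measure_pmf.expectation \<mu> f"
proof -
  have "integrable (count_space UNIV) (\<lambda>j. pmf \<mu> j * f j)"
    using assms by (simp add: integrable_measure_pmf_nat_iff integrable_count_space_nat_iff)
  moreover have "measure_pmf.expectation \<mu> f = integral\<^sup>L (count_space UNIV) (\<lambda>j. pmf \<mu> j * f j)"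
    by (simp add: measure_pmf_eq_density integral_density)
  ultimately show ?thesis using sums_integral_count_space_nat by metis
qed

text \<open>The terms are nonnegative, so convergence of the series is already
  integrability.\<close>

lemma has_mean_iff: "has_mean \<mu> x \<longleftrightarrow> (\<lambda>j. pmf \<mu> j * real j) sums x"
  unfolding has_mean_def using sums_expectation_pmf_nat[of \<mu> real]
  by (auto simp: integrable_measure_pmf_nat_iff sums_iff)

lemma pmf_sums_one: "pmf (\<mu> :: nat pmf) sums 1"
  using sums_expectation_pmf_nat[of \<mu> "\<lambda>_. 1"] by simp

lemma pmf_sums_shift:
  assumes "\<mu> \<in> prob_measures b"
  shows "(\<lambda>i. pmf \<mu> (b + i)) sums 1"
proof -
  have "pmf \<mu> j = 0" if "j < b" for j
    using assms that by (auto simp: prob_measures_def set_pmf_iff)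
  then show ?thesis
    using sums_iff_shift[of "pmf \<mu>" b 1] pmf_sums_one[of \<mu>] by (simp add: add.commute)
qed

text \<open>This is \<open>ln t \<le> t - 1\<close> at \<open>t = y / x\<close>.\<close>

lemma mult_ln_div_ge:
  fixes x y :: real
  assumes "x \<ge> 0" "y > 0"
  shows "x - y \<le> x * ln (x / y)"
proof (cases "x = 0")
  case False
  then have "ln (y / x) \<le> y / x - 1" using assms by (intro ln_le_minus_one) auto
  then have "x * ln (y / x) \<le> y - x" using assms False by (simp add: field_simps)
  then show ?thesis using assms False by (simp add: ln_div algebra_simps)
qed (use assms in auto)

text \<open>Subtracting \<open>\<theta>\<^sub>j - \<rho>\<^sub>j\<close>, which sums to zero, makes all terms of the relative entropy
  nonnegative.\<close>

lemma rel_entropy_sums: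
  assumes "\<theta> \<in> prob_measures b" "\<rho> \<in> prob_measures b" and pos: "\<And>j. j \<ge> b \<Longrightarrow> pmf \<rho> j > 0"
  shows "(\<lambda>i. ereal (pmf \<theta> (b + i) * ln (pmf \<theta> (b + i) / pmf \<rho> (b + i)))) sums rel_entropy b \<theta> \<rho>"
    and rel_entropy_nonneg: "rel_entropy b \<theta> \<rho> \<ge> 0"
proof -
  define f where "f i = pmf \<theta> (b + i) * ln (pmf \<theta> (b + i) / pmf \<rho> (b + i))" for i
  define d where "d i = pmf \<theta> (b + i) - pmf \<rho> (b + i)" for i
  have d: "d sums 0" using sums_diff[OF pmf_sums_shift[OF assms(1)] pmf_sums_shift[OF assms(2)]]
    by (simp add: d_def[abs_def])
  have g: "f i - d i \<ge> 0" for i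
    using mult_ln_div_ge[of "pmf \<theta> (b + i)" "pmf \<rho> (b + i)"] pos[of "b + i"] by (simp add: f_def d_def)
  define L where "L = (\<Sum>i. ereal (f i - d i))"
  have L: "(\<lambda>i. ereal (f i - d i)) sums L"
    unfolding L_def using g by (intro summable_sums summable_ereal_pos) simp
  have L0: "L \<ge> 0" unfolding L_def using g by (intro suminf_0_le summable_ereal_pos) auto
  \<comment> \<open>The partial sums of \<open>f\<close> are those of \<open>f - d\<close> plus
    those of \<open>d\<close>, which tend to 0; only the first limit can be infinite.\<close>
  have "(\<lambda>n. (\<Sum>i<n. ereal (f i - d i)) + ereal (\<Sum>i<n. d i)) \<longlonglongrightarrow> L + ereal 0"
    using L d by (intro tendsto_add_ereal_general) (auto simp: sums_def)
  then have "(\<lambda>n. \<Sum>i<n. ereal (f i)) \<longlonglongrightarrow> L"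
    by (simp add: sum_subtractf)
  then have s: "(\<lambda>i. ereal (f i)) sums L" by (simp add: sums_def)
  then have "L = rel_entropy b \<theta> \<rho>" by (simp add: rel_entropy_def f_def sums_iff)
  with s L0 show "(\<lambda>i. ereal (pmf \<theta> (b + i) * ln (pmf \<theta> (b + i) / pmf \<rho> (b + i)))) sums rel_entropy b \<theta> \<rho>"
    and "rel_entropy b \<theta> \<rho> \<ge> 0" by (auto simp: f_def)
qed

lemma rel_entropy_self: "rel_entropy b \<rho> \<rho> = 0"
proof -
  have *: "x * ln (x / x) = 0" for x :: real by (cases "x = 0") auto
  show ?thesis unfolding rel_entropy_def * by (simp flip: zero_ereal_def)
qed

lemma rel_entropy_finite_support:
  assumes "finite S" "S \<subseteq> {b..}" "set_pmf \<theta> \<subseteq> S"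
  shows "rel_entropy b \<theta> \<rho> = ereal (\<Sum>j\<in>S. pmf \<theta> j * ln (pmf \<theta> j / pmf \<rho> j))"
proof -
  define f where "f j = pmf \<theta> j * ln (pmf \<theta> j / pmf \<rho> j)" for j
  have S: "S = (+) b ` ((\<lambda>j. j - b) ` S)" using assms(2) by (force simp: image_image)
  have "(\<Sum>i. ereal (f (b + i))) = (\<Sum>i\<in>(\<lambda>j. j - b) ` S. ereal (f (b + i)))"
  proof (rule suminf_finite)
    fix i assume "i \<notin> (\<lambda>j. j - b) ` S"
    then have "b + i \<notin> S" by force
    then show "ereal (f (b + i)) = 0" using assms(3) by (auto simp: f_def set_pmf_iff)
  qed (use assms in auto)
  also have "\<dots> = ereal (\<Sum>i\<in>(\<lambda>j. j - b) ` S. f (b + i))" by simp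
  also have "(\<Sum>i\<in>(\<lambda>j. j - b) ` S. f (b + i)) = (\<Sum>j\<in>S. f j)"
    by (subst (2) S, subst sum.reindex) (auto simp: inj_on_def)
  finally show ?thesis by (simp add: rel_entropy_def f_def)
qed

section \<open>The tilted distribution with mean \<open>c\<close>\<close>

lemma pmf_rho_pos: "\<alpha> > 0 \<Longrightarrow> j \<ge> b \<Longrightarrow> pmf (rho b \<alpha>) j > 0"
  by (simp add: pmf_rho Zb_pos)

lemma rho_in_prob_measures: "\<alpha> > 0 \<Longrightarrow> rho b \<alpha> \<in> prob_measures b"
  by (auto simp: prob_measures_def set_pmf_iff pmf_rho split: if_splits)

text \<open>From \<open>j * \<alpha>^j / j! = \<alpha> * \<alpha>^(j-1) / (j-1)!\<close> the first
  moment is \<alpha> times the normalizer with \<open>b\<close> lowered by one (unchanged if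
  \<open>b = 0\<close>), and that is at least \<open>Zb b \<alpha>\<close>. So the mean of
  \<open>rho b \<alpha>\<close> is at least \<alpha>.\<close>

lemma first_moment_sums:
  assumes "\<alpha> > 0"
  shows "\<exists>s \<ge> \<alpha> * Zb b \<alpha>. (\<lambda>i. real (i + b) * (\<alpha> ^ (i + b) / fact (i + b))) sums s"
proof -
  have step: "real (Suc n) * (\<alpha> ^ Suc n / fact (Suc n)) = \<alpha> * (\<alpha> ^ n / fact n)" for n
    by (simp add: fact_Suc del: of_nat_Suc)
  show ?thesis
  proof (cases b)
    case 0
    have "(\<lambda>i. \<alpha> * (\<alpha> ^ i / fact i)) sums (\<alpha> * Zb 0 \<alpha>)"
      using sums_mult[OF Zb_sums[of \<alpha> 0]] by simp
    then have "(\<lambda>i. real (Suc i) * (\<alpha> ^ (Suc i) / fact (Suc i))) sums (\<alpha> * Zb 0 \<alpha>)"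
      unfolding step .
    \<comment> \<open>For \<open>b = 0\<close> the shift of the index loses nothing, because the
      term at 0 vanishes.\<close>
    then show ?thesis
      using sums_Suc_iff[of "\<lambda>i. real i * (\<alpha> ^ i / fact i)"] 0 by auto
  next
    case (Suc b')
    have "(\<lambda>i. \<alpha> * (\<alpha> ^ (i + b') / fact (i + b'))) sums (\<alpha> * Zb b' \<alpha>)"
      by (rule sums_mult[OF Zb_sums])
    then have "(\<lambda>i. real (i + b) * (\<alpha> ^ (i + b) / fact (i + b))) sums (\<alpha> * Zb b' \<alpha>)"
      unfolding Suc add_Suc_right step .
    moreover have "Zb b' \<alpha> \<ge> Zb b \<alpha>" using assms by (simp add: Zb_def Suc)
    ultimately show ?thesis using assms by (intro exI[of _ "\<alpha> * Zb b' \<alpha>"]) auto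
  qed
qed

text \<open>Clearing the normalizer turns the mean condition into the vanishing of a series in
  powers of \<alpha>, the form used for both uniqueness and existence.\<close>

lemma has_mean_rho_iff:
  assumes "\<alpha> > 0"
  shows "has_mean (rho b \<alpha>) c \<longleftrightarrow> (\<lambda>i. (real (i + b) - c) * (\<alpha> ^ (i + b) / fact (i + b))) sums 0"
proof -
  define Z where "Z = Zb b \<alpha>"
  have Z: "Z > 0" using Zb_pos[OF assms] by (simp add: Z_def)
  have "has_mean (rho b \<alpha>) c \<longleftrightarrow> (\<lambda>i. pmf (rho b \<alpha>) (i + b) * real (i + b)) sums c"
    unfolding has_mean_iff by (subst sums_iff_shift[of _ b]) (simp add: pmf_rho assms)
  also have "\<dots> \<longleftrightarrow> (\<lambda>i. Z * (pmf (rho b \<alpha>) (i + b) * real (i + b))) sums (Z * c)"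
    using Z by (subst sums_mult_iff) auto
  also have "(\<lambda>i. Z * (pmf (rho b \<alpha>) (i + b) * real (i + b))) =
      (\<lambda>i. real (i + b) * (\<alpha> ^ (i + b) / fact (i + b)))"
    using Z by (auto simp: pmf_rho assms Z_def)
  also have "\<dots> sums (Z * c) \<longleftrightarrow> (\<lambda>i. (real (i + b) - c) * (\<alpha> ^ (i + b) / fact (i + b))) sums 0"
  proof -
    have *: "(\<lambda>i. c * (\<alpha> ^ (i + b) / fact (i + b))) sums (Z * c)"
      using sums_mult[OF Zb_sums[of \<alpha> b], of c] by (simp add: Z_def mult.commute)
    show ?thesis
    proof
      assume "(\<lambda>i. real (i + b) * (\<alpha> ^ (i + b) / fact (i + b))) sums (Z * c)"
      from sums_diff[OF this *] show "(\<lambda>i. (real (i + b) - c) * (\<alpha> ^ (i + b) / fact (i + b))) sums 0"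
        by (simp only: left_diff_distrib diff_self)
    next
      assume "(\<lambda>i. (real (i + b) - c) * (\<alpha> ^ (i + b) / fact (i + b))) sums 0"
      from sums_add[OF this *] show "(\<lambda>i. real (i + b) * (\<alpha> ^ (i + b) / fact (i + b))) sums (Z * c)"
        by (simp only: left_diff_distrib diff_add_cancel add_0)
    qed
  qed
  finally show ?thesis .
qed

text \<open>For \<open>\<alpha> < \<beta>\<close> the weights \<open>t ^ j\<close>, \<open>t = \<beta> / \<alpha>\<close>, tilt \<open>\<rho>\<^sub>b\<^sub>,\<^sub>\<alpha>\<close> to the right, which increases
  the mean strictly.\<close>

lemma has_mean_rho_unique:
  assumes ab: "0 < \<alpha>" "\<alpha> < \<beta>" and c: "real b < c"
    and ma: "has_mean (rho b \<alpha>) c" and mb: "has_mean (rho b \<beta>) c"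
  shows False
proof -
  define w where "w i = \<alpha> ^ (i + b) / fact (i + b)" for i
  define t where "t = \<beta> / \<alpha>"
  have t: "t > 1" using ab by (simp add: t_def)
  \<comment> \<open>Subtracting \<open>t powr c\<close> times the series for \<alpha> from the
    series for \<beta> gives terms whose first two factors both change sign at \<open>c\<close>, so
    every term is nonnegative.\<close>
  define h where "h i = (real (i + b) - c) * (t powr real (i + b) - t powr c) * w i" for i
  have 1: "(\<lambda>i. (real (i + b) - c) * w i) sums 0"
    using ma has_mean_rho_iff[OF ab(1)] by (simp add: w_def)
  have "(\<lambda>i. (real (i + b) - c) * (t ^ (i + b) * w i)) sums 0"
    using mb has_mean_rho_iff[of \<beta> b c] ab by (simp add: w_def t_def power_divide)
  moreover have "t ^ n = t powr real n" for n using t by (simp add: powr_realpow)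
  ultimately have "(\<lambda>i. (real (i + b) - c) * (t powr real (i + b) * w i)) sums 0" by simp
  from sums_diff[OF this sums_mult[OF 1, of "t powr c"]]
  have h: "h sums 0" unfolding h_def by (simp add: algebra_simps)
  have nn: "h i \<ge> 0" for i
  proof -
    have "(real (i + b) - c) * (t powr real (i + b) - t powr c) \<ge> 0"
      using t by (cases "real (i + b) \<le> c") (auto intro: mult_nonpos_nonpos mult_nonneg_nonneg powr_mono)
    moreover have "w i \<ge> 0" using ab by (simp add: w_def)
    ultimately show ?thesis by (simp add: h_def)
  qed
  \<comment> \<open>Index 0 stands for the occupation number \<open>b < c\<close>, where both
    factors are strictly negative.\<close>
  have "h 0 > 0" unfolding h_def w_def using t c ab
    by (intro mult_pos_pos mult_neg_neg) (auto simp: powr_less_mono)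
  then have "suminf h > 0" using suminf_pos2[OF sums_summable[OF h] nn] by blast
  then show False using h by (simp add: sums_iff)
qed

text \<open>Divided by \<open>x ^ b\<close>, the equation becomes \<open>G x = 0\<close> for an
  everywhere convergent power series \<open>G\<close>. It is negative at 0 because
  \<open>b < c\<close>, and positive at \<open>c + 1\<close>, where the mean exceeds
  \<open>c\<close>; the intermediate value theorem applies.\<close>

lemma has_mean_rho_exists:
  assumes c: "real b < c"
  shows "\<exists>\<alpha>>0. has_mean (rho b \<alpha>) c"
proof -
  define a where "a i = (real (i + b) - c) / fact (i + b)" for i
  have shift: "a i * x ^ i = ((real (i + b) - c) * (x ^ (i + b) / fact (i + b))) / x ^ b" if "x \<noteq> 0" for i x
    using that by (simp add: a_def power_add)
  have sm: "summable (\<lambda>i. a i * x ^ i) \<and> (x > c \<longrightarrow> suminf (\<lambda>i. a i * x ^ i) > 0)" if x: "x > 0" for x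
  proof -
    obtain s where s: "s \<ge> x * Zb b x" "(\<lambda>i. real (i + b) * (x ^ (i + b) / fact (i + b))) sums s"
      using first_moment_sums[OF x] by blast
    have "(\<lambda>i. (real (i + b) - c) * (x ^ (i + b) / fact (i + b))) sums (s - c * Zb b x)"
      using sums_diff[OF s(2) sums_mult[OF Zb_sums[of x b], of c]] by (simp only: left_diff_distrib)
    from sums_divide[OF this, of "x ^ b"] have sum: "(\<lambda>i. a i * x ^ i) sums ((s - c * Zb b x) / x ^ b)"
      using x shift by simp
    have "s - c * Zb b x \<ge> (x - c) * Zb b x" using s by (simp add: algebra_simps)
    moreover have "(x - c) * Zb b x > 0" if "x > c" using that Zb_pos[OF x] by simp
    ultimately show ?thesis using sum x by (auto simp: sums_iff)
  qed
  \<comment> \<open>Convergence at \<open>\<bar>x\<bar> + 1\<close> puts \<open>x\<close> strictly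
    inside the disc of convergence.\<close>
  have all: "summable (\<lambda>i. a i * x ^ i)" for x
  proof -
    have "norm x < norm (\<bar>x\<bar> + 1)" by simp
    then show ?thesis using powser_inside[of a "\<bar>x\<bar> + 1" x] sm[of "\<bar>x\<bar> + 1"] by auto
  qed
  define G where "G x = (\<Sum>i. a i * x ^ i)" for x
  have cont: "isCont G x" for x
    unfolding G_def using isCont_powser_converges_everywhere[of a] all by blast
  have "G 0 < 0" using c unfolding G_def powser_zero by (simp add: a_def divide_neg_pos)
  moreover have "G (c + 1) > 0" using sm[of "c + 1"] c by (simp add: G_def)
  ultimately obtain x where x: "0 \<le> x" "G x = 0"
    using IVT[of G 0 0 "c + 1"] cont c by fastforce
  with \<open>G 0 < 0\<close> have x0: "x > 0" by (cases "x = 0") auto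
  have "(\<lambda>i. a i * x ^ i) sums 0" using all[of x] x by (simp add: sums_iff G_def)
  from sums_mult[OF this, of "x ^ b"] have "has_mean (rho b x) c"
    unfolding has_mean_rho_iff[OF x0] using x0 by (simp add: shift)
  with x0 show ?thesis by blast
qed

lemma alpha_pos_mean:
  assumes "real b < c"
  shows "alpha b c > 0" "has_mean (rho b (alpha b c)) c"
proof -
  have "\<exists>!\<alpha>. \<alpha> > 0 \<and> has_mean (rho b \<alpha>) c"
    using has_mean_rho_exists[OF assms] has_mean_rho_unique[OF _ _ assms] by (metis linorder_neqE)
  from theI'[OF this] show "alpha b c > 0" "has_mean (rho b (alpha b c)) c"
    by (simp_all add: alpha_def)
qed

lemma rho_alpha_mem: "real b < c \<Longrightarrow> rho b (alpha b c) \<in> prob_measures_mean b c"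
  using alpha_pos_mean[of b c] rho_in_prob_measures[of "alpha b c" b]
  by (simp add: prob_measures_mean_def)

section \<open>The Prohorov metric and total variation\<close>

text \<open>Total variation distance at most \<delta>; one inequality suffices, since complements
  give the reverse one. Approximations are measured in this sense because it involves no enlargement
  of sets.\<close>

definition tv_le :: "'a pmf \<Rightarrow> 'a pmf \<Rightarrow> real \<Rightarrow> bool" where
  "tv_le \<mu> \<nu> \<delta> \<longleftrightarrow> (\<forall>A. measure_pmf.prob \<mu> A \<le> measure_pmf.prob \<nu> A + \<delta>)"

lemma tv_le_sym: "tv_le \<mu> \<nu> \<delta> \<Longrightarrow> tv_le \<nu> \<mu> \<delta>"
  unfolding tv_le_def
proof
  fix A assume "\<forall>A. measure_pmf.prob \<mu> A \<le> measure_pmf.prob \<nu> A + \<delta>"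
  then have "measure_pmf.prob \<mu> (- A) \<le> measure_pmf.prob \<nu> (- A) + \<delta>" by blast
  then show "measure_pmf.prob \<nu> A \<le> measure_pmf.prob \<mu> A + \<delta>"
    using measure_pmf.prob_compl[of A \<mu>] measure_pmf.prob_compl[of A \<nu>]
    by (simp add: Compl_eq_Diff_UNIV)
qed

lemma prohorov_less_iff:
  "prohorov b \<mu> \<nu> < r \<longleftrightarrow> (\<exists>\<epsilon>>0. \<epsilon> < r \<and> (\<forall>A\<subseteq>{b..}.
     measure_pmf.prob \<mu> A \<le> measure_pmf.prob \<nu> {x\<in>{b..}. \<exists>a\<in>A. dist x a < \<epsilon>} + \<epsilon> \<and>
     measure_pmf.prob \<nu> A \<le> measure_pmf.prob \<mu> {x\<in>{b..}. \<exists>a\<in>A. dist x a < \<epsilon>} + \<epsilon>))"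
proof -
  define E where "E = {\<epsilon>::real. \<epsilon> > 0 \<and> (\<forall>A\<subseteq>{b..}.
     measure_pmf.prob \<mu> A \<le> measure_pmf.prob \<nu> {x\<in>{b..}. \<exists>a\<in>A. dist x a < \<epsilon>} + \<epsilon> \<and>
     measure_pmf.prob \<nu> A \<le> measure_pmf.prob \<mu> {x\<in>{b..}. \<exists>a\<in>A. dist x a < \<epsilon>} + \<epsilon>)}"
  \<comment> \<open>Probabilities are at most 1, so the infimum is taken over a nonempty
    set.\<close>
  have "1 \<in> E" unfolding E_def
    by (auto intro!: order.trans[OF measure_pmf.prob_le_1])
  moreover have "bdd_below E" by (rule bdd_belowI[of _ 0]) (auto simp: E_def)
  moreover have "prohorov b \<mu> \<nu> = Inf E" by (simp add: prohorov_def E_def Let_def)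
  ultimately have "prohorov b \<mu> \<nu> < r \<longleftrightarrow> (\<exists>\<epsilon>\<in>E. \<epsilon> < r)"
    using cInf_less_iff[of E r] by auto
  then show ?thesis unfolding E_def by blast
qed

text \<open>A witness \<epsilon> below \<open>r\<close> leaves a gap; half of the gap absorbs a
  change of \<mu> in total variation, and the neighbourhoods only grow with \<epsilon>. Hence
  Prohorov balls are open in total variation.\<close>

lemma prohorov_tv_open:
  assumes "prohorov b \<theta> \<mu> < r"
  obtains \<delta> where "\<delta> > 0" "\<And>\<nu>. tv_le \<mu> \<nu> \<delta> \<Longrightarrow> prohorov b \<theta> \<nu> < r"
proof -
  obtain \<epsilon> where \<epsilon>: "\<epsilon> > 0" "\<epsilon> < r" and cl: "\<And>A. A \<subseteq> {b..} \<Longrightarrow>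
     measure_pmf.prob \<theta> A \<le> measure_pmf.prob \<mu> {x\<in>{b..}. \<exists>a\<in>A. dist x a < \<epsilon>} + \<epsilon> \<and>
     measure_pmf.prob \<mu> A \<le> measure_pmf.prob \<theta> {x\<in>{b..}. \<exists>a\<in>A. dist x a < \<epsilon>} + \<epsilon>"
    using assms unfolding prohorov_less_iff by blast
  define \<delta> where "\<delta> = (r - \<epsilon>) / 2"
  have \<delta>: "\<delta> > 0" "\<epsilon> + \<delta> < r" using \<epsilon> by (auto simp: \<delta>_def field_simps)
  have "prohorov b \<theta> \<nu> < r" if tv: "tv_le \<mu> \<nu> \<delta>" for \<nu>
    unfolding prohorov_less_iff
  proof (intro exI[of _ "\<epsilon> + \<delta>"] conjI allI impI)
    fix A :: "nat set" assume A: "A \<subseteq> {b..}"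
    let ?A = "\<lambda>\<epsilon>. {x\<in>{b..}. \<exists>a\<in>A. dist x a < \<epsilon>}"
    have mono: "measure_pmf.prob p (?A \<epsilon>) \<le> measure_pmf.prob p (?A (\<epsilon> + \<delta>))" for p
      using \<delta> by (intro measure_pmf.finite_measure_mono) force+
    have "measure_pmf.prob \<mu> (?A \<epsilon>) \<le> measure_pmf.prob \<nu> (?A \<epsilon>) + \<delta>"
      "measure_pmf.prob \<nu> A \<le> measure_pmf.prob \<mu> A + \<delta>"
      using tv tv_le_sym[OF tv] by (auto simp: tv_le_def)
    with cl[OF A] mono[of \<nu>] mono[of \<theta>]
    show "measure_pmf.prob \<theta> A \<le> measure_pmf.prob \<nu> (?A (\<epsilon> + \<delta>)) + (\<epsilon> + \<delta>)"
      "measure_pmf.prob \<nu> A \<le> measure_pmf.prob \<theta> (?A (\<epsilon> + \<delta>)) + (\<epsilon> + \<delta>)" by linarith+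
  qed (use \<epsilon> \<delta> in auto)
  with \<delta> that show thesis by blast
qed

lemma prohorov_self_less:
  assumes "r > 0"
  shows "prohorov b \<theta> \<theta> < r"
  unfolding prohorov_less_iff
proof (intro exI[of _ "r / 2"] conjI allI impI)
  fix A :: "nat set" assume A: "A \<subseteq> {b..}"
  then have "measure_pmf.prob \<theta> A \<le> measure_pmf.prob \<theta> {x\<in>{b..}. \<exists>a\<in>A. dist x a < r / 2}"
    using assms by (intro measure_pmf.finite_measure_mono) force+
  then show "measure_pmf.prob \<theta> A \<le> measure_pmf.prob \<theta> {x\<in>{b..}. \<exists>a\<in>A. dist x a < r / 2} + r / 2"
    "measure_pmf.prob \<theta> A \<le> measure_pmf.prob \<theta> {x\<in>{b..}. \<exists>a\<in>A. dist x a < r / 2} + r / 2"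
    using assms by linarith+
qed (use assms in auto)

text \<open>Total variation is measured by the excess of \<mu> over \<nu>: inside \<open>S\<close>
  it is at most \<open>\<eta> j\<close> at each point, and the mass of \<mu> outside
  \<open>S\<close> is counted in full.\<close>

lemma tv_le_pointwise:
  fixes \<mu> \<nu> :: "nat pmf"
  assumes "finite S" "\<And>j. j \<in> S \<Longrightarrow> pmf \<mu> j - \<eta> j \<le> pmf \<nu> j" "\<And>j. j \<in> S \<Longrightarrow> 0 \<le> \<eta> j"
    and "(\<Sum>j\<in>S. \<eta> j) + (1 - measure_pmf.prob \<mu> S) \<le> \<delta>"
  shows "tv_le \<mu> \<nu> \<delta>"
  unfolding tv_le_def
proof
  fix A
  have "measure_pmf.prob \<mu> A \<le> measure_pmf.prob \<mu> (A \<inter> S \<union> - S)"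
    by (intro measure_pmf.finite_measure_mono) auto
  also have "\<dots> \<le> measure_pmf.prob \<mu> (A \<inter> S) + measure_pmf.prob \<mu> (- S)"
    by (intro measure_Un_le) auto
  also have "measure_pmf.prob \<mu> (- S) = 1 - measure_pmf.prob \<mu> S"
    using measure_pmf.prob_compl[of S \<mu>] by (simp add: Compl_eq_Diff_UNIV)
  also have "measure_pmf.prob \<mu> (A \<inter> S) = (\<Sum>j\<in>A \<inter> S. pmf \<mu> j)"
    using assms(1) by (simp add: measure_measure_pmf_finite)
  also have "\<dots> \<le> (\<Sum>j\<in>A \<inter> S. pmf \<nu> j + \<eta> j)"
    using assms(2) by (intro sum_mono) (auto simp: algebra_simps)
  also have "\<dots> \<le> measure_pmf.prob \<nu> A + (\<Sum>j\<in>S. \<eta> j)"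
  proof -
    have "(\<Sum>j\<in>A \<inter> S. pmf \<nu> j) = measure_pmf.prob \<nu> (A \<inter> S)"
      using assms(1) by (simp add: measure_measure_pmf_finite)
    also have "\<dots> \<le> measure_pmf.prob \<nu> A" by (intro measure_pmf.finite_measure_mono) auto
    finally show ?thesis
      using sum_mono2[of S "A \<inter> S" \<eta>] assms(1,3) by (simp add: sum.distrib add_mono)
  qed
  finally show "measure_pmf.prob \<mu> A \<le> measure_pmf.prob \<nu> A + \<delta>" using assms(4) by linarith
qed

section \<open>Entropy of types\<close>

lemma sum_mset_eq_sum_count:
  fixes f :: "'a \<Rightarrow> real"
  assumes "finite S" "set_mset T \<subseteq> S"
  shows "(\<Sum>x\<in>#T. f x) = (\<Sum>x\<in>S. real (count T x) * f x)"
  using assms(2)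
proof (induction T)
  case (add a T)
  have "(\<Sum>x\<in>S. real (count (add_mset a T) x) * f x) =
      (\<Sum>x\<in>S. real (count T x) * f x + (if x = a then f a else 0))"
    by (intro sum.cong) (auto simp: distrib_right)
  also have "\<dots> = (\<Sum>x\<in>S. real (count T x) * f x) + f a"
    using add.prems assms(1) by (simp add: sum.distrib)
  finally show ?case using add by simp
qed simp

lemma of_nat_sum_mset: "real (sum_mset T) = (\<Sum>x\<in>#T. real x)"
  by (induction T) auto

lemma real_size_eq_sum_count:
  "finite S \<Longrightarrow> set_mset T \<subseteq> S \<Longrightarrow> real (size T) = (\<Sum>x\<in>S. real (count T x))"
  using sum_mset_eq_sum_count[of S T "\<lambda>_. 1"] by simp

lemma real_sum_mset_eq_sum_count:
  "finite S \<Longrightarrow> set_mset T \<subseteq> S \<Longrightarrow> real (sum_mset T) = (\<Sum>x\<in>S. real (count T x) * real x)"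
  using sum_mset_eq_sum_count[of S T real] by (simp add: of_nat_sum_mset)

text \<open>Beyond being a configuration, membership is a condition on the type alone, so
  \<open>Omega b N K M\<close> is a union of type fibers.\<close>

lemma Omega_iff:
  "\<omega> \<in> Omega b N K M \<longleftrightarrow> \<omega> \<in> configs N K \<and> set_mset (type_mset N K \<omega>) \<subseteq> {b..} \<and>
     card (set_mset (type_mset N K \<omega>)) \<le> M"
proof -
  have "{j \<in> {b..}. 1 \<le> num_sites N K \<omega> j} = set_mset (type_mset N K \<omega>) \<inter> {b..}"
    by (auto simp flip: count_type_mset simp: Suc_le_eq)
  moreover have "(\<forall>l\<in>{1..N}. b \<le> occ K \<omega> l) \<longleftrightarrow> set_mset (type_mset N K \<omega>) \<subseteq> {b..}"
    by (auto simp: type_mset_def)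
  ultimately show ?thesis by (auto simp: Omega_def num_pos_def Int_absorb2)
qed

lemma pmf_Theta_count:
  assumes "\<omega> \<in> Omega b N K M" "N > 0"
  shows "pmf (Theta b N K \<omega>) j = real (count (type_mset N K \<omega>) j) / real N"
proof (cases "b \<le> j")
  case False
  then have "count (type_mset N K \<omega>) j = 0"
    using assms(1) by (auto simp: Omega_iff count_eq_zero_iff)
  then show ?thesis using False by (simp add: pmf_Theta[OF assms])
qed (simp add: pmf_Theta[OF assms] count_type_mset)

lemma set_pmf_Theta:
  assumes "\<omega> \<in> Omega b N K M" "N > 0"
  shows "set_pmf (Theta b N K \<omega>) = set_mset (type_mset N K \<omega>)"
  using assms(2) by (auto simp: set_pmf_iff pmf_Theta_count[OF assms])

lemma Theta_mean:
  assumes w: "\<omega> \<in> Omega b N K M" and N: "N > 0" and K: "real K = c * real N"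
  shows "Theta b N K \<omega> \<in> prob_measures_mean b c"
proof -
  define T where "T = type_mset N K \<omega>"
  have "(\<lambda>j. pmf (Theta b N K \<omega>) j * real j) sums (\<Sum>j\<in>set_mset T. pmf (Theta b N K \<omega>) j * real j)"
    using set_pmf_Theta[OF w N] by (intro sums_finite) (simp_all add: T_def pmf_eq_0_set_pmf)
  also have "(\<Sum>j\<in>set_mset T. pmf (Theta b N K \<omega>) j * real j) = real (sum_mset T) / real N"
    using real_sum_mset_eq_sum_count[of "set_mset T" T]
    by (simp add: pmf_Theta_count[OF w N] T_def sum_divide_distrib)
  also have "sum_mset T = K"
    using w sum_mset_type_mset by (simp add: Omega_iff T_def)
  also have "real K / real N = c" using K N by simp
  finally have "has_mean (Theta b N K \<omega>) c" by (simp add: has_mean_iff)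
  then show ?thesis
    using set_pmf_Theta[OF w N] w by (auto simp: prob_measures_mean_def prob_measures_def Omega_iff)
qed

lemma type_fiber_Omega:
  assumes "\<omega> \<in> Omega b N K M" "\<omega>' \<in> type_fiber N K (type_mset N K \<omega>)"
  shows "\<omega>' \<in> Omega b N K M" "Theta b N K \<omega>' = Theta b N K \<omega>"
proof -
  have eq: "\<omega>' \<in> configs N K" "type_mset N K \<omega>' = type_mset N K \<omega>"
    using assms(2) by (auto simp: type_fiber_def)
  then show "\<omega>' \<in> Omega b N K M" using assms(1) by (simp add: Omega_iff)
  have "num_sites N K \<omega>' = num_sites N K \<omega>"
    using eq(2) by (intro ext) (metis count_type_mset)
  then show "Theta b N K \<omega>' = Theta b N K \<omega>" unfolding Theta_def by (simp only:)
qed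

text \<open>The type-independent part that is left when \<open>- real N * r\<close>, with
  \<open>r\<close> the entropy, is split off from the logarithm of a fiber's size. The terms in
  \<alpha> and \<open>Zb b \<alpha>\<close> come from \<open>ln (pmf (rho b \<alpha>) j)\<close>;
  summed over a type they depend on \<open>N\<close> and \<open>K\<close> only.\<close>

definition log_card_const :: "nat \<Rightarrow> nat \<Rightarrow> nat \<Rightarrow> real \<Rightarrow> real" where
  "log_card_const b N K \<alpha> = ln (fact N) - real N * ln (real N) + real N + ln (fact K)
     - real K * ln \<alpha> + real N * ln (Zb b \<alpha>)"

lemma ln_card_type_fiber:
  assumes sz: "size T = N" and sm: "sum_mset T = K"
  shows "card (type_fiber N K T) > 0"
    and "ln (real (card (type_fiber N K T))) =
      ln (fact N) + ln (fact K) - (\<Sum>j\<in>set_mset T. ln (fact (count T j)))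
        - (\<Sum>j\<in>set_mset T. real (count T j) * ln (fact j))"
proof -
  define p where "p = (\<Prod>j\<in>set_mset T. fact (count T j) :: nat)"
  define q where "q = prod_mset (image_mset fact T :: nat multiset)"
  have eq: "card (type_fiber N K T) * (p * q) = fact N * fact K"
    using card_type_fiber[OF assms] by (simp add: p_def q_def)
  show pos: "card (type_fiber N K T) > 0" using eq by (metis fact_nonzero mult_eq_0_iff neq0_conv)
  have p: "p > 0" by (simp add: p_def prod_pos)
  have "q > 0 \<and> ln (real q) = (\<Sum>j\<in>#T. ln (fact j))"
    unfolding q_def by (induction T) (auto simp: ln_mult)
  then have q: "q > 0" "ln (real q) = (\<Sum>j\<in>set_mset T. real (count T j) * ln (fact j))"
    using sum_mset_eq_sum_count[of "set_mset T" T "\<lambda>j. ln (fact j)"] by auto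
  have "real (card (type_fiber N K T)) * (real p * real q) = fact N * fact K"
    using arg_cong[OF eq, of real] by simp
  then have "ln (real (card (type_fiber N K T))) + (ln (real p) + ln (real q)) = ln (fact N) + ln (fact K)"
    using pos p q(1) by (metis (no_types, lifting) fact_gt_zero ln_mult_pos mult_pos_pos of_nat_0_less_iff)
  moreover have "ln (real p) = (\<Sum>j\<in>set_mset T. ln (fact (count T j)))"
    by (simp add: p_def ln_prod)
  ultimately show "ln (real (card (type_fiber N K T))) =
      ln (fact N) + ln (fact K) - (\<Sum>j\<in>set_mset T. ln (fact (count T j)))
        - (\<Sum>j\<in>set_mset T. real (count T j) * ln (fact j))" using q(2) by linarith
qed

text \<open>After the entropy is expanded, the error left is the sum of
  \<open>ln (fact (count T j)) - cnt j * ln (cnt j)\<close>, plus \<open>N\<close>. By Stirling each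
  term lies between \<open>- cnt j\<close> and \<open>ln N + 1 - cnt j\<close>; the counts add up to
  \<open>N\<close>, and at most \<open>M\<close> of them are nonzero.\<close>

lemma type_fiber_bounds:
  assumes w: "\<omega> \<in> Omega b N K M" and N: "N > 0" and \<alpha>: "\<alpha> > 0"
  obtains r where "rel_entropy b (Theta b N K \<omega>) (rho b \<alpha>) = ereal r"
    "real (card (type_fiber N K (type_mset N K \<omega>))) \<le> exp (log_card_const b N K \<alpha> - real N * r)"
    "exp (log_card_const b N K \<alpha> - real N * r - real M * (ln (real N) + 1))
       \<le> real (card (type_fiber N K (type_mset N K \<omega>)))"
proof -
  define T where "T = type_mset N K \<omega>"
  define S where "S = set_mset T"
  define \<theta> where "\<theta> = Theta b N K \<omega>"
  define r where "r = (\<Sum>j\<in>S. pmf \<theta> j * ln (pmf \<theta> j / pmf (rho b \<alpha>) j))"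
  define cnt where "cnt j = real (count T j)" for j
  have S: "finite S" "S \<subseteq> {b..}" "card S \<le> M" using w by (auto simp: S_def T_def Omega_iff)
  have sz: "size T = N" by (simp add: T_def size_type_mset)
  have sm: "sum_mset T = K" using w by (simp add: T_def sum_mset_type_mset Omega_iff)
  have sumcnt: "(\<Sum>j\<in>S. cnt j) = real N"
    using real_size_eq_sum_count[of S T] sz S by (simp add: cnt_def S_def)
  have summom: "(\<Sum>j\<in>S. cnt j * real j) = real K"
    using real_sum_mset_eq_sum_count[of S T] sm S by (simp add: cnt_def S_def)
  have cnt1: "count T j \<ge> 1" if "j \<in> S" for j using that by (simp add: S_def Suc_le_eq)
  have cntN: "count T j \<le> N" for j using count_le_size[of T j] sz by simp
  have re: "rel_entropy b \<theta> (rho b \<alpha>) = ereal r"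
    unfolding r_def by (rule rel_entropy_finite_support)
      (use S set_pmf_Theta[OF w N] in \<open>auto simp: \<theta>_def S_def T_def\<close>)
  \<comment> \<open>Here \<open>pmf \<theta> j = cnt j / N\<close>. Summed over \<open>j\<close>,
    the last three terms are fixed by the size and the sum of the type; the first two also appear in
    the counting formula.\<close>
  have term_eq: "real N * (pmf \<theta> j * ln (pmf \<theta> j / pmf (rho b \<alpha>) j)) =
      cnt j * ln (cnt j) + cnt j * ln (fact j) - ln (real N) * cnt j - ln \<alpha> * (cnt j * real j)
        + ln (Zb b \<alpha>) * cnt j" if j: "j \<in> S" for j
  proof -
    have c0: "cnt j > 0" using cnt1[OF j] by (simp add: cnt_def)
    have jb: "b \<le> j" using j S by auto
    have "ln (pmf \<theta> j / pmf (rho b \<alpha>) j) = ln ((cnt j / real N) / ((\<alpha> ^ j / fact j) / Zb b \<alpha>))"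
      using jb by (simp add: pmf_rho[OF \<alpha>] \<theta>_def pmf_Theta_count[OF w N] cnt_def T_def)
    also have "\<dots> = ln (cnt j) - ln (real N) - (real j * ln \<alpha> - ln (fact j) - ln (Zb b \<alpha>))"
      using c0 N \<alpha> Zb_pos[OF \<alpha>, of b] by (simp add: ln_div ln_mult ln_realpow)
    finally show ?thesis
      using N by (simp add: \<theta>_def pmf_Theta_count[OF w N] flip: T_def cnt_def) (simp add: algebra_simps)
  qed
  have "real N * r = (\<Sum>j\<in>S. cnt j * ln (cnt j) + cnt j * ln (fact j) - ln (real N) * cnt j
      - ln \<alpha> * (cnt j * real j) + ln (Zb b \<alpha>) * cnt j)"
    unfolding r_def sum_distrib_left by (intro sum.cong refl term_eq)
  also have "\<dots> = (\<Sum>j\<in>S. cnt j * ln (cnt j)) + (\<Sum>j\<in>S. cnt j * ln (fact j)) - real N * ln (real N)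
      - real K * ln \<alpha> + real N * ln (Zb b \<alpha>)"
    by (simp add: sum.distrib sum_subtractf sumcnt summom flip: sum_distrib_left)
  finally have Nr: "real N * r = (\<Sum>j\<in>S. cnt j * ln (cnt j)) + (\<Sum>j\<in>S. cnt j * ln (fact j))
      - real N * ln (real N) - real K * ln \<alpha> + real N * ln (Zb b \<alpha>)" .
  note card = ln_card_type_fiber[OF sz sm]
  have ln_eq: "ln (real (card (type_fiber N K T))) = log_card_const b N K \<alpha> - real N * r - real N
      - (\<Sum>j\<in>S. ln (fact (count T j)) - cnt j * ln (cnt j))"
    unfolding card(2) Nr log_card_const_def by (simp add: sum_subtractf S_def cnt_def algebra_simps)
  have "(\<Sum>j\<in>S. - cnt j) \<le> (\<Sum>j\<in>S. ln (fact (count T j)) - cnt j * ln (cnt j))"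
    using ln_fact_ge by (intro sum_mono) (simp add: cnt_def algebra_simps)
  then have "ln (real (card (type_fiber N K T))) \<le> log_card_const b N K \<alpha> - real N * r"
    unfolding ln_eq by (simp add: sum_negf sumcnt)
  then have up: "real (card (type_fiber N K T)) \<le> exp (log_card_const b N K \<alpha> - real N * r)"
    using card(1) by (metis exp_le_cancel_iff exp_ln of_nat_0_less_iff)
  have "(\<Sum>j\<in>S. ln (fact (count T j)) - cnt j * ln (cnt j)) \<le> (\<Sum>j\<in>S. (ln (real N) + 1) - cnt j)"
  proof (intro sum_mono)
    fix j assume j: "j \<in> S"
    have "ln (cnt j) \<le> ln (real N)" unfolding cnt_def
      by (rule iffD2[OF ln_le_cancel_iff]) (use cnt1[OF j] cntN[of j] in linarith)+
    then show "ln (fact (count T j)) - cnt j * ln (cnt j) \<le> (ln (real N) + 1) - cnt j"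
      using ln_fact_le[OF cnt1[OF j]] by (simp add: cnt_def)
  qed
  also have "\<dots> = real (card S) * (ln (real N) + 1) - real N"
    by (simp add: sum_subtractf sumcnt)
  also have "\<dots> \<le> real M * (ln (real N) + 1) - real N"
    using S(3) N by (simp add: mult_right_mono)
  finally have "log_card_const b N K \<alpha> - real N * r - real M * (ln (real N) + 1)
      \<le> ln (real (card (type_fiber N K T)))" unfolding ln_eq by simp
  then have "exp (log_card_const b N K \<alpha> - real N * r - real M * (ln (real N) + 1))
      \<le> real (card (type_fiber N K T))"
    using card(1) by (simp add: ln_ge_iff)
  with re up that show thesis by (simp add: T_def \<theta>_def)
qed

text \<open>A type is encoded by the graph of its count function on its support, a set of at most
  \<open>M\<close> pairs in \<open>{..K} \<times> {..N}\<close>; such a set consists of the entries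
  of some list of length exactly \<open>M\<close>.\<close>

lemma card_types_le:
  assumes "N > 0"
  shows "card (type_mset N K ` Omega b N K M) \<le> ((K + 1) * (N + 1)) ^ M"
proof -
  define Q where "Q = {..K} \<times> {..N}"
  define gr where "gr T = (\<lambda>j. (j, count T j)) ` set_mset T" for T :: "nat multiset"
  have inj: "inj gr"
  proof (rule injI, rule multiset_eqI)
    fix S T j assume eq: "gr S = gr T"
    have mem: "(j, i) \<in> gr U \<longleftrightarrow> i > 0 \<and> count U j = i" for i and U :: "nat multiset"
      by (auto simp: gr_def)
    have "i > 0 \<and> count S j = i \<longleftrightarrow> i > 0 \<and> count T j = i" for i
      using mem[of _ S] mem[of _ T] eq by auto
    then show "count S j = count T j" by (metis not_gr_zero)
  qed
  have "gr ` type_mset N K ` Omega b N K M \<subseteq> set ` {xs. set xs \<subseteq> Q \<and> length xs = M}"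
  proof (intro image_subsetI, elim imageE, hypsubst)
    fix \<omega> assume w: "\<omega> \<in> Omega b N K M"
    define T where "T = type_mset N K \<omega>"
    have sz: "size T = N" by (simp add: T_def size_type_mset)
    have sm: "sum_mset T = K" using w by (simp add: T_def sum_mset_type_mset Omega_iff)
    have sub: "gr T \<subseteq> Q"
    proof
      fix x assume "x \<in> gr T"
      then obtain j where j: "j \<in># T" "x = (j, count T j)" by (auto simp: gr_def)
      have "j \<le> sum_mset T" using j(1) by (metis le_add1 multi_member_split sum_mset.add_mset)
      then show "x \<in> Q" using sm sz count_le_size[of T j] j by (auto simp: Q_def)
    qed
    have "card (gr T) \<le> M" using w card_image_le[of "set_mset T" "\<lambda>j. (j, count T j)"]
      by (auto simp: gr_def T_def Omega_iff)
    have ne: "gr T \<noteq> {}" using sz assms by (auto simp: gr_def)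
    obtain xs where xs: "set xs = gr T" "length xs = card (gr T)"
      using finite_distinct_list[of "gr T"] distinct_card by (metis finite_imageI finite_set_mset gr_def)
    \<comment> \<open>Repeating the head pads the list to length \<open>M\<close> without a new
      entry; there is a head because \<open>N > 0\<close> makes the type nonempty.\<close>
    have "hd xs \<in> set xs" using ne xs by (cases xs) auto
    then have "set (replicate (M - length xs) (hd xs)) \<subseteq> set xs" by (simp add: set_replicate_conv_if)
    then have "set (xs @ replicate (M - length xs) (hd xs)) = gr T"
      using xs(1) by (metis set_append sup.orderE)
    moreover have "length (xs @ replicate (M - length xs) (hd xs)) = M"
      using xs(2) \<open>card (gr T) \<le> M\<close> by simp
    ultimately show "gr (type_mset N K \<omega>) \<in> set ` {xs. set xs \<subseteq> Q \<and> length xs = M}"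
      using sub unfolding T_def by (metis (mono_tags, lifting) image_eqI mem_Collect_eq)
  qed
  then have "card (gr ` type_mset N K ` Omega b N K M) \<le> card (set ` {xs. set xs \<subseteq> Q \<and> length xs = M})"
    by (intro card_mono finite_imageI finite_lists_length_eq) (auto simp: Q_def)
  also have "\<dots> \<le> card {xs. set xs \<subseteq> Q \<and> length xs = M}"
    by (intro card_image_le finite_lists_length_eq) (auto simp: Q_def)
  also have "\<dots> = ((K + 1) * (N + 1)) ^ M"
    by (subst card_lists_length_eq) (auto simp: Q_def)
  finally show ?thesis
    by (subst (asm) card_image) (auto intro: inj_on_subset[OF inj])
qed

section \<open>Approximation by types\<close>

lemma exists_mset_size_sum:
  "b * r \<le> M \<Longrightarrow> M \<le> n * r \<Longrightarrow> \<exists>T. set_mset T \<subseteq> {b..n} \<and> size T = r \<and> sum_mset T = M"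
  for b n r M :: nat
proof (induction r arbitrary: M)
  case (Suc r)
  have bn: "b \<le> n" using order.trans[OF Suc.prems] by (simp only: mult_le_cancel2)
  \<comment> \<open>Greedy choice: the smallest value from \<open>b\<close> on that leaves at most
    \<open>n * r\<close> particles for the other \<open>r\<close> sites. The subtraction is
    truncated, so \<open>x = b\<close> if the others could take everything.\<close>
  define x where "x = max b (M - n * r)"
  have x: "b \<le> x" "x \<le> n" "x \<le> M" using Suc.prems bn by (auto simp: x_def)
  have nr: "b * r \<le> n * r" using bn by simp
  \<comment> \<open>The products \<open>b * r\<close> and \<open>n * r\<close> are abstracted to
    \<open>v\<close> and \<open>u\<close>, which makes the claim linear.\<close>
  have "max b (M - u) + v \<le> M \<and> M \<le> max b (M - u) + u"
    if "b + v \<le> M" "M \<le> n + u" "v \<le> u" for u v using that by linarith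
  from this[of "b * r" "n * r"] have "x + b * r \<le> M" "M \<le> x + n * r"
    using Suc.prems nr by (simp_all add: x_def)
  then have "b * r \<le> M - x" "M - x \<le> n * r" by linarith+
  from Suc.IH[OF this] obtain T where T: "set_mset T \<subseteq> {b..n}" "size T = r" "sum_mset T = M - x" by blast
  show ?case by (rule exI[of _ "add_mset x T"]) (use T x in auto)
qed (auto intro: exI[of _ "{#}"])

lemma finite_support_sums:
  assumes "\<mu> \<in> prob_measures_mean b c" "set_pmf \<mu> \<subseteq> S" "finite S"
  shows "(\<Sum>j\<in>S. pmf \<mu> j) = 1" "(\<Sum>j\<in>S. pmf \<mu> j * real j) = c"
proof -
  have 0: "pmf \<mu> j = 0" if "j \<notin> S" for j using that assms(2) by (auto simp: pmf_eq_0_set_pmf)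
  show "(\<Sum>j\<in>S. pmf \<mu> j) = 1" using assms(2,3) sum_pmf_eq_1 by blast
  have "(\<lambda>j. pmf \<mu> j * real j) sums (\<Sum>j\<in>S. pmf \<mu> j * real j)"
    using 0 by (intro sums_finite assms) auto
  then show "(\<Sum>j\<in>S. pmf \<mu> j * real j) = c"
    using assms(1) by (auto simp: prob_measures_mean_def has_mean_iff sums_iff)
qed

text \<open>Rounding down leaves \<open>r\<close> sites and \<open>M\<close> particles with \<open>b r \<le> M \<le> n r\<close>, and these fit into
  \<open>{b..n}\<close> again.\<close>

lemma exists_mset_rounding:
  assumes mu: "\<mu> \<in> prob_measures_mean b c" "set_pmf \<mu> \<subseteq> {b..n}" and K: "real K = c * real N"
  shows "\<exists>T. set_mset T \<subseteq> {b..n} \<and> size T = N \<and> sum_mset T = K \<and>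
    (\<forall>j. \<bar>real (count T j) - real N * pmf \<mu> j\<bar> \<le> real n + 1)"
proof -
  define S where "S = {b..n}"
  have fS: "finite S" by (simp add: S_def)
  define fl where "fl j = nat \<lfloor>real N * pmf \<mu> j\<rfloor>" for j
  define e where "e j = real N * pmf \<mu> j - real (fl j)" for j
  have e: "0 \<le> e j" "e j \<le> 1" for j
  proof -
    have "real (fl j) = of_int \<lfloor>real N * pmf \<mu> j\<rfloor>" by (simp add: fl_def)
    then show "0 \<le> e j" "e j \<le> 1" unfolding e_def by linarith+
  qed
  have sum_fl: "real (\<Sum>j\<in>S. fl j) = real N - (\<Sum>j\<in>S. e j)"
    using finite_support_sums(1)[OF mu(1), of S] mu(2)
    by (simp add: e_def sum_subtractf S_def flip: sum_distrib_left)
  have "real (\<Sum>j\<in>S. fl j * j) = (\<Sum>j\<in>S. real N * (pmf \<mu> j * real j) - e j * real j)"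
    by (simp add: e_def algebra_simps)
  also have "\<dots> = real K - (\<Sum>j\<in>S. e j * real j)"
    using finite_support_sums(2)[OF mu(1), of S] mu(2) K
    by (simp add: sum_subtractf S_def flip: sum_distrib_left)
  finally have sum_flj: "real (\<Sum>j\<in>S. fl j * j) = real K - (\<Sum>j\<in>S. e j * real j)" .
  define r where "r = N - (\<Sum>j\<in>S. fl j)"
  define M where "M = K - (\<Sum>j\<in>S. fl j * j)"
  have "(\<Sum>j\<in>S. e j) \<ge> 0" "(\<Sum>j\<in>S. e j * real j) \<ge> 0" using e by (auto intro!: sum_nonneg)
  then have le: "(\<Sum>j\<in>S. fl j) \<le> N" "(\<Sum>j\<in>S. fl j * j) \<le> K"
    using sum_fl sum_flj by linarith+
  have r: "real r = (\<Sum>j\<in>S. e j)" using le(1) sum_fl by (simp add: r_def of_nat_diff)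
  have M: "real M = (\<Sum>j\<in>S. e j * real j)" using le(2) sum_flj by (simp add: M_def of_nat_diff)
  \<comment> \<open>Termwise, since \<open>b \<le> j \<le> n\<close> on \<open>S\<close>; this is
    the condition for distributing \<open>M\<close> particles over \<open>r\<close> sites.\<close>
  have "real (b * r) \<le> real M" "real M \<le> real (n * r)"
    unfolding M of_nat_mult r sum_distrib_left
    by (auto intro!: sum_mono simp: S_def e mult.commute[of "e _"] mult_right_mono)
  then obtain T1 where T1: "set_mset T1 \<subseteq> {b..n}" "size T1 = r" "sum_mset T1 = M"
    using exists_mset_size_sum[of b r M n] by (auto simp only: of_nat_le_iff)
  \<comment> \<open>Each of the at most \<open>n + 1\<close> values loses at most one site by
    rounding; this yields the constant \<open>n + 1\<close> of the claim.\<close>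
  have "real r \<le> (\<Sum>j\<in>S. 1)" unfolding r using e by (intro sum_mono) auto
  then have rn: "real r \<le> real n + 1" by (simp add: S_def)
  define T0 where "T0 = (\<Sum>j\<in>S. replicate_mset (fl j) j)"
  have cnt0: "count T0 j = (if j \<in> S then fl j else 0)" for j
    using fS by (auto simp: T0_def count_sum)
  have sub0: "set_mset T0 \<subseteq> S" using cnt0 by (metis count_eq_zero_iff subsetI)
  have "real (sum_mset T0) = real (\<Sum>j\<in>S. fl j * j)"
    using real_sum_mset_eq_sum_count[OF fS sub0] by (simp add: cnt0)
  then have sm0: "sum_mset T0 = (\<Sum>j\<in>S. fl j * j)" by (simp only: of_nat_eq_iff)
  have sz0: "size T0 = (\<Sum>j\<in>S. fl j)" by (simp add: T0_def size_multiset_sum)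
  show ?thesis
  proof (intro exI[of _ "T0 + T1"] conjI allI)
    show "set_mset (T0 + T1) \<subseteq> {b..n}" using sub0 T1 by (auto simp: S_def)
    show "size (T0 + T1) = N" using sz0 T1 le by (simp add: r_def)
    show "sum_mset (T0 + T1) = K" using sm0 T1 le by (simp add: M_def)
    fix j
    show "\<bar>real (count (T0 + T1) j) - real N * pmf \<mu> j\<bar> \<le> real n + 1"
    proof (cases "j \<in> S")
      case True
      have "real (count T1 j) \<le> real n + 1" using count_le_size[of T1 j] T1(2) rn by linarith
      moreover have "real (count (T0 + T1) j) - real N * pmf \<mu> j = real (count T1 j) - e j"
        using True by (simp add: cnt0 e_def)
      ultimately show ?thesis using e[of j] by linarith
    next
      case False
      then have "count T1 j = 0" "pmf \<mu> j = 0"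
        using T1(1) mu(2) by (auto simp: S_def count_eq_zero_iff pmf_eq_0_set_pmf)
      then show ?thesis using False by (simp add: cnt0)
    qed
  qed
qed

text \<open>The delicate point is 0, where \<open>x * ln (x / y)\<close> tends to 0 and also has the
  value 0. So points without mass need no separate treatment when entropies converge.\<close>

lemma continuous_on_mult_ln_div:
  assumes "y > 0"
  shows "continuous_on {0..} (\<lambda>x::real. x * ln (x / y))"
  unfolding continuous_on_def
proof
  fix x :: real assume "x \<in> {0..}"
  then consider "x = 0" | "x > 0" by fastforce
  then show "((\<lambda>x. x * ln (x / y)) \<longlongrightarrow> x * ln (x / y)) (at x within {0..})"
  proof cases
    case 1
    have "((\<lambda>x. x * ln (x / y)) \<longlongrightarrow> 0) (at_right 0)" using assms by real_asymp
    moreover have "at (0::real) within {0..} = at_right 0"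
      by (simp add: at_within_Ici_at_right)
    ultimately show ?thesis using 1 by simp
  next
    case 2
    have "((\<lambda>x. x * ln (x / y)) \<longlongrightarrow> x * ln (x / y)) (at x)"
      using 2 assms by (intro tendsto_intros) auto
    then show ?thesis by (rule tendsto_within_subset) auto
  qed
qed

lemma tendsto_mult_ln_div:
  assumes "y > (0::real)" "(f \<longlongrightarrow> l) F" "l \<ge> 0" "\<forall>\<^sub>F x in F. f x \<ge> 0"
  shows "((\<lambda>x. f x * ln (f x / y)) \<longlongrightarrow> l * ln (l / y)) F"
  using continuous_on_tendsto_compose[OF continuous_on_mult_ln_div[OF assms(1)] assms(2)] assms(3,4)
  by simp

section \<open>Limits along the admissible \<open>N\<close>\<close>

lemma along_le: "along c \<le> sequentially"
  by (simp add: along_def)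

lemma eventually_along: "(\<forall>\<^sub>F N in along c. P N) \<longleftrightarrow> (\<forall>\<^sub>F N in sequentially. N \<in> admissible c \<longrightarrow> P N)"
  by (simp add: along_def eventually_inf_principal)

lemma eventually_admissible: "\<forall>\<^sub>F N in along c. N \<in> admissible c"
  by (simp add: eventually_along)

lemma num_particles_admissible:
  assumes "N \<in> admissible c" "c \<ge> 0"
  shows "real (num_particles c N) = c * real N"
proof -
  obtain k where k: "c * real N = of_int k" using assms(1) by (auto simp: admissible_def Ints_def)
  moreover have "k \<ge> 0" using k assms(2) by (metis mult_nonneg_nonneg of_int_0_le_iff of_nat_0_le_iff)
  ultimately show ?thesis by (simp add: num_particles_def)
qed

text \<open>The rounded types converge to \<mu> at every point of the fixed finite set
  \<open>S\<close>, hence in total variation and in entropy, a finite sum of continuous terms. At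
  most \<open>card S\<close> occupation numbers occur, which \<open>m N\<close> eventually
  admits.\<close>

lemma eventually_near_type:
  assumes mu: "\<mu> \<in> prob_measures_mean b c" "set_pmf \<mu> \<subseteq> {b..n}" and \<alpha>: "\<alpha> > 0" and \<delta>: "\<delta> > 0"
    and c: "c \<ge> 0" and m_inf: "filterlim m at_top (along c)"
  shows "\<forall>\<^sub>F N in along c. \<exists>\<omega>\<in>Omega b N (num_particles c N) (m N).
    tv_le \<mu> (Theta b N (num_particles c N) \<omega>) \<delta> \<and>
    rel_entropy b (Theta b N (num_particles c N) \<omega>) (rho b \<alpha>) \<le> rel_entropy b \<mu> (rho b \<alpha>) + ereal \<delta>"
proof -
  define S where "S = {b..n}"
  define K where "K = num_particles c"
  have "\<exists>T. N \<in> admissible c \<longrightarrow> set_mset T \<subseteq> S \<and> size T = N \<and> sum_mset T = K N \<and>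
      (\<forall>j. \<bar>real (count T j) - real N * pmf \<mu> j\<bar> \<le> real n + 1)" for N
    using exists_mset_rounding[OF mu, of "K N" N] num_particles_admissible[of N c] c
    by (auto simp: K_def S_def)
  then obtain T where T: "\<And>N. N \<in> admissible c \<Longrightarrow> set_mset (T N) \<subseteq> S \<and> size (T N) = N \<and>
      sum_mset (T N) = K N \<and> (\<forall>j. \<bar>real (count (T N) j) - real N * pmf \<mu> j\<bar> \<le> real n + 1)"
    by metis
  define p where "p N j = real (count (T N) j) / real N" for N j
  have dist: "\<bar>p N j - pmf \<mu> j\<bar> \<le> (real n + 1) / real N" if "N \<in> admissible c" for N j
  proof -
    have N: "real N > 0" using that by (auto simp: admissible_def)
    then have "\<bar>p N j - pmf \<mu> j\<bar> = \<bar>real (count (T N) j) - real N * pmf \<mu> j\<bar> / real N"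
      by (simp add: p_def field_simps flip: abs_divide[of _ "real N", simplified])
    also have "\<dots> \<le> (real n + 1) / real N" using T[OF that] N by (intro divide_right_mono) auto
    finally show ?thesis .
  qed
  have lim0: "((\<lambda>N. (real n + 1) / real N) \<longlongrightarrow> 0) (along c)"
    by (rule tendsto_mono[OF along_le]) real_asymp
  have p_lim: "((\<lambda>N. p N j) \<longlongrightarrow> pmf \<mu> j) (along c)" for j
  proof (rule LIM_zero_cancel, rule Lim_null_comparison[OF _ lim0])
    show "\<forall>\<^sub>F N in along c. norm (p N j - pmf \<mu> j) \<le> (real n + 1) / real N"
      using eventually_admissible by eventually_elim (use dist in auto)
  qed
  have "((\<lambda>N. \<Sum>j\<in>S. p N j * ln (p N j / pmf (rho b \<alpha>) j)) \<longlongrightarrow>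
      (\<Sum>j\<in>S. pmf \<mu> j * ln (pmf \<mu> j / pmf (rho b \<alpha>) j))) (along c)"
    by (intro tendsto_sum tendsto_mult_ln_div p_lim) (auto simp: p_def S_def pmf_rho_pos[OF \<alpha>])
  then have ev1: "\<forall>\<^sub>F N in along c. (\<Sum>j\<in>S. p N j * ln (p N j / pmf (rho b \<alpha>) j)) <
      (\<Sum>j\<in>S. pmf \<mu> j * ln (pmf \<mu> j / pmf (rho b \<alpha>) j)) + \<delta>"
    using \<delta> by (intro order_tendstoD) auto
  have "((\<lambda>N. real (card S) * ((real n + 1) / real N)) \<longlongrightarrow> 0) (along c)"
    using tendsto_mult_right_zero[OF lim0] by simp
  then have ev2: "\<forall>\<^sub>F N in along c. real (card S) * ((real n + 1) / real N) < \<delta>"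
    using \<delta> by (intro order_tendstoD) auto
  have ev3: "\<forall>\<^sub>F N in along c. card S \<le> m N"
    using m_inf by (simp add: filterlim_at_top)
  from ev1 ev2 ev3 eventually_admissible show ?thesis
  proof eventually_elim
    case (elim N)
    note T = T[OF elim(4)]
    have N: "N > 0" using elim(4) by (auto simp: admissible_def)
    \<comment> \<open>By the counting formula every multiset of the right size and sum is the type
      of some configuration.\<close>
    have "card (type_fiber N (K N) (T N)) > 0"
      using ln_card_type_fiber(1) T by blast
    then obtain \<omega> where w: "\<omega> \<in> type_fiber N (K N) (T N)" by (metis card_gt_0_iff ex_in_conv)
    then have ty: "type_mset N (K N) \<omega> = T N" by (simp add: type_fiber_def)
    have "card (set_mset (T N)) \<le> card S" using T by (intro card_mono) (auto simp: S_def)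
    then have wO: "\<omega> \<in> Omega b N (K N) (m N)"
      using w T elim(3) by (auto simp: Omega_iff type_fiber_def S_def)
    define \<theta> where "\<theta> = Theta b N (K N) \<omega>"
    have pm: "pmf \<theta> j = p N j" for j by (simp add: \<theta>_def pmf_Theta_count[OF wO N] ty p_def)
    have sub: "set_pmf \<theta> \<subseteq> S" using set_pmf_Theta[OF wO N] T ty by (simp add: \<theta>_def)
    have "tv_le \<mu> \<theta> \<delta>"
    proof (rule tv_le_pointwise[of S _ "\<lambda>_. (real n + 1) / real N"])
      show "pmf \<mu> j - (real n + 1) / real N \<le> pmf \<theta> j" for j
        using dist[OF elim(4), of j] by (simp add: pm abs_le_iff)
      have "measure_pmf.prob \<mu> S = 1"
        using finite_support_sums(1)[OF mu(1), of S] mu(2) by (simp add: S_def measure_measure_pmf_finite)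
      then show "(\<Sum>j\<in>S. (real n + 1) / real N) + (1 - measure_pmf.prob \<mu> S) \<le> \<delta>"
        using elim(2) by simp
    qed (auto simp: S_def)
    moreover have "rel_entropy b \<theta> (rho b \<alpha>) \<le> rel_entropy b \<mu> (rho b \<alpha>) + ereal \<delta>"
      using elim(1) rel_entropy_finite_support[of S b \<theta> "rho b \<alpha>"] sub
        rel_entropy_finite_support[of S b \<mu> "rho b \<alpha>"] mu(2)
      by (simp add: S_def pm)
    ultimately show ?case using wO by (auto simp: \<theta>_def K_def)
  qed
qed

section \<open>Approximation by finitely supported measures\<close>

lemma prob_measures_mean_subset_le:
  "real b < c \<Longrightarrow> prob_measures_mean b c \<subseteq> prob_measures_mean_le b c"
  by (auto simp: prob_measures_mean_def prob_measures_mean_le_def intro: bexI[of _ c])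

lemma prob_atMost: "measure_pmf.prob \<theta> {..n} = (\<Sum>j\<le>n. pmf \<theta> j)" for n :: nat
  by (simp add: measure_measure_pmf_finite)

text \<open>The pmf \<open>\<nu>\<close> is \<open>(1 - \<epsilon>) \<theta>(\<cdot> | {..n}) + \<epsilon> \<delta>\<^sub>J\<close>, where \<open>\<epsilon>\<close> is chosen to make the mean equal to
  \<open>c\<close>, and \<open>s\<close>, \<open>q\<close> are the mass and the first moment of \<open>\<theta>\<close> on \<open>{..n}\<close>.\<close>

lemma truncated_mixture:
  fixes n J b :: nat and c :: real
  assumes th: "\<theta> \<in> prob_measures_mean_le b c" and J: "c < real J" "b \<le> J" and n: "c \<le> real n"
    and s_def: "s = (\<Sum>j\<le>n. pmf \<theta> j)" and q_def: "q = (\<Sum>j\<le>n. pmf \<theta> j * real j)" and s: "s > 0"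
  obtains \<nu> where "\<nu> \<in> prob_measures_mean b c" "set_pmf \<nu> \<subseteq> {b..max n J}" "real J * s - q > 0" "q \<le> c * s"
    "\<And>j. pmf \<nu> j = (real J - c) / (real J * s - q) * (if j \<le> n then pmf \<theta> j else 0)
        + (if j = J then (c * s - q) / (real J * s - q) else 0)"
proof -
  obtain x where x: "x \<le> c" "(\<lambda>j. pmf \<theta> j * real j) sums x" and thb: "set_pmf \<theta> \<subseteq> {b..}"
    using th by (auto simp: prob_measures_mean_le_def prob_measures_def has_mean_iff)
  have "(\<lambda>j. pmf \<theta> j * real j - c * pmf \<theta> j) sums (x - c * 1)"
    by (intro sums_diff sums_mult x pmf_sums_one)
  \<comment> \<open>The omitted terms are nonnegative because \<open>c \<le> n\<close>, so
    truncation can only lower the total \<open>x - c\<close>, which is at most 0 already.\<close>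
  then have "(\<Sum>j\<le>n. pmf \<theta> j * real j - c * pmf \<theta> j) \<le> x - c"
  proof (subst sums_unique[of _ "x - c"], simp, intro sum_le_suminf)
    fix j assume "j \<in> - {..n}"
    then have "c \<le> real j" using n by auto
    then show "0 \<le> pmf \<theta> j * real j - c * pmf \<theta> j" by (simp add: mult.commute mult_right_mono)
  qed (auto simp: sums_iff)
  then have q: "q \<le> c * s" using x(1) by (simp add: sum_subtractf s_def q_def sum_distrib_left)
  define D where "D = real J * s - q"
  have "(real J - c) * s > 0" using J s by simp
  then have D: "D > 0" using q by (simp add: D_def algebra_simps)
  \<comment> \<open>Cramer's rule for \<open>\<kappa> * s + \<epsilon> = 1\<close> and
    \<open>\<kappa> * q + \<epsilon> * J = c\<close>, the conditions on mass and mean;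
    \<open>D\<close> is the determinant.\<close>
  define \<kappa> where "\<kappa> = (real J - c) / D"
  define \<epsilon> where "\<epsilon> = (c * s - q) / D"
  have nn: "\<kappa> \<ge> 0" "\<epsilon> \<ge> 0" using J q D by (auto simp: \<kappa>_def \<epsilon>_def)
  define f where "f j = \<kappa> * (if j \<le> n then pmf \<theta> j else 0) + (if j = J then \<epsilon> else 0)" for j
  define S where "S = {..max n J}"
  have fnn: "f j \<ge> 0" for j using nn by (simp add: f_def)
  have f0: "f j = 0" if "j \<notin> S" for j using that by (auto simp: f_def S_def)
  have sumn: "(\<Sum>j\<in>S. (if j \<le> n then g j else 0)) = (\<Sum>j\<le>n. g j)" for g :: "nat \<Rightarrow> real"
    by (rule sum.mono_neutral_cong_right) (auto simp: S_def)
  have "(\<Sum>j\<in>S. f j) = \<kappa> * s + \<epsilon>"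
    by (simp add: f_def sum.distrib sumn s_def flip: sum_distrib_left) (simp add: S_def)
  also have "\<dots> = ((real J - c) * s + (c * s - q)) / D" by (simp add: \<kappa>_def \<epsilon>_def add_divide_distrib)
  also have "\<dots> = 1" using D by (simp add: D_def algebra_simps)
  finally have sumf: "(\<Sum>j\<in>S. f j) = 1" .
  have "(\<Sum>j\<in>S. f j * real j) = (\<Sum>j\<in>S. \<kappa> * (if j \<le> n then pmf \<theta> j * real j else 0) + (if j = J then \<epsilon> * real J else 0))"
    by (intro sum.cong) (auto simp: f_def algebra_simps)
  also have "\<dots> = \<kappa> * q + \<epsilon> * real J"
    by (simp add: sum.distrib sumn q_def flip: sum_distrib_left) (simp add: S_def)
  also have "\<dots> = ((real J - c) * q + (c * s - q) * real J) / D" by (simp add: \<kappa>_def \<epsilon>_def add_divide_distrib)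
  also have "(real J - c) * q + (c * s - q) * real J = c * D" by (simp add: D_def algebra_simps)
  finally have sumfj: "(\<Sum>j\<in>S. f j * real j) = c" using D by simp
  define \<nu> where "\<nu> = embed_pmf f"
  have "(\<integral>\<^sup>+ x. ennreal (f x) \<partial>count_space UNIV) = (\<Sum>j\<in>S. ennreal (f j))"
    using f0 by (intro nn_integral_count_space'[of S]) (auto simp: S_def)
  also have "\<dots> = 1" using sumf fnn by (simp add: sum_ennreal)
  finally have pmf_nu: "pmf \<nu> j = f j" for j
    unfolding \<nu>_def using fnn by (intro pmf_embed_pmf) auto
  have supp: "set_pmf \<nu> \<subseteq> {b..max n J}"
  proof
    fix j assume "j \<in> set_pmf \<nu>"
    then have fj: "f j \<noteq> 0" by (simp add: set_pmf_iff pmf_nu)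
    then have "j \<in> S" using f0 by blast
    moreover have "b \<le> j"
    proof (rule ccontr)
      assume "\<not> b \<le> j"
      then have "pmf \<theta> j = 0" "j \<noteq> J" using thb J(2) by (auto simp: pmf_eq_0_set_pmf)
      then show False using fj by (auto simp: f_def split: if_splits)
    qed
    ultimately show "j \<in> {b..max n J}" by (simp add: S_def)
  qed
  have "(\<lambda>j. f j * real j) sums (\<Sum>j\<in>S. f j * real j)"
    using f0 by (intro sums_finite) (auto simp: S_def)
  then have "has_mean \<nu> c" by (simp add: has_mean_iff pmf_nu sumfj)
  then have "\<nu> \<in> prob_measures_mean b c"
    using supp by (auto simp: prob_measures_mean_def prob_measures_def)
  then show thesis
    using that[of \<nu>] supp D q by (simp add: pmf_nu f_def D_def \<kappa>_def \<epsilon>_def)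
qed

text \<open>Mass is lost in two ways: by rescaling with \<kappa> and by cutting off the
  tail.\<close>

lemma tv_le_truncated:
  fixes n :: nat
  assumes "\<And>j. j \<le> n \<Longrightarrow> pmf \<nu> j \<ge> \<kappa> * pmf \<theta> j" and "\<bar>1 - \<kappa>\<bar> + (1 - (\<Sum>j\<le>n. pmf \<theta> j)) \<le> \<delta>"
  shows "tv_le \<theta> \<nu> \<delta>"
proof (rule tv_le_pointwise[of "{..n}" _ "\<lambda>j. \<bar>1 - \<kappa>\<bar> * pmf \<theta> j"])
  fix j assume j: "j \<in> {..n}"
  have "(1 - \<kappa>) * pmf \<theta> j \<le> \<bar>1 - \<kappa>\<bar> * pmf \<theta> j" by (intro mult_right_mono) auto
  then show "pmf \<theta> j - \<bar>1 - \<kappa>\<bar> * pmf \<theta> j \<le> pmf \<nu> j"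
    using assms(1)[of j] j by (simp add: algebra_simps)
next
  have s1: "(\<Sum>j\<le>n. pmf \<theta> j) \<le> 1" unfolding prob_atMost[symmetric] by simp
  have "(\<Sum>j\<in>{..n}. \<bar>1 - \<kappa>\<bar> * pmf \<theta> j) = \<bar>1 - \<kappa>\<bar> * (\<Sum>j\<le>n. pmf \<theta> j)"
    by (simp add: sum_distrib_left)
  also have "\<dots> \<le> \<bar>1 - \<kappa>\<bar> * 1" using s1 by (intro mult_left_mono) auto
  finally show "(\<Sum>j\<in>{..n}. \<bar>1 - \<kappa>\<bar> * pmf \<theta> j) + (1 - measure_pmf.prob \<theta> {..n}) \<le> \<delta>"
    using assms(2) by (simp add: prob_atMost)
qed auto

lemma truncation_limits:
  assumes "(\<lambda>j. pmf \<theta> j * real j) sums x" and "x < real J"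
  shows "(\<lambda>n. \<Sum>j\<le>n. pmf \<theta> j) \<longlonglongrightarrow> 1"
    and "(\<lambda>n. \<Sum>j\<le>n. pmf \<theta> j * real j) \<longlonglongrightarrow> x"
    and "(\<lambda>n. a / (real J * (\<Sum>j\<le>n. pmf \<theta> j) - (\<Sum>j\<le>n. pmf \<theta> j * real j))) \<longlonglongrightarrow> a / (real J - x)"
proof -
  show s: "(\<lambda>n. \<Sum>j\<le>n. pmf \<theta> j) \<longlonglongrightarrow> 1" using pmf_sums_one[of \<theta>] by (simp add: sums_def_le)
  show q: "(\<lambda>n. \<Sum>j\<le>n. pmf \<theta> j * real j) \<longlonglongrightarrow> x" using assms(1) by (simp add: sums_def_le)
  have "(\<lambda>n. a / (real J * (\<Sum>j\<le>n. pmf \<theta> j) - (\<Sum>j\<le>n. pmf \<theta> j * real j))) \<longlonglongrightarrow> a / (real J * 1 - x)"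
    using assms(2) by (intro tendsto_intros s q) auto
  then show "(\<lambda>n. a / (real J * (\<Sum>j\<le>n. pmf \<theta> j) - (\<Sum>j\<le>n. pmf \<theta> j * real j))) \<longlonglongrightarrow> a / (real J - x)"
    by simp
qed

text \<open>The missing mean \<open>c - x\<close> is supplied by a mass at a remote point
  \<open>J\<close>: far out, arbitrarily little mass is enough. This puts measures of mean
  \<open>c\<close> into balls around measures of smaller mean.\<close>

lemma exists_finite_support_near:
  assumes th: "\<theta> \<in> prob_measures_mean_le b c" and c: "real b < c" and \<delta>: "\<delta> > 0"
  shows "\<exists>\<nu>\<in>prob_measures_mean b c. finite (set_pmf \<nu>) \<and> tv_le \<theta> \<nu> \<delta>"
proof -
  obtain x where x: "x \<le> c" "(\<lambda>j. pmf \<theta> j * real j) sums x"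
    using th by (auto simp: prob_measures_mean_le_def has_mean_iff)
  \<comment> \<open>As \<open>n\<close> grows, the mass put on \<open>J\<close> tends to
    \<open>(c - x) / (J - x)\<close>; the second bound makes this smaller than \<delta>.\<close>
  obtain J :: nat where "max c (x + (c - x) / \<delta>) < real J" using reals_Archimedean2 by blast
  then have J: "c < real J" "x + (c - x) / \<delta> < real J" by auto
  have Jb: "b \<le> J" using J(1) c by linarith
  have xJ: "x < real J" using x J by linarith
  define s where "s n = (\<Sum>j\<le>n. pmf \<theta> j)" for n
  define q where "q n = (\<Sum>j\<le>n. pmf \<theta> j * real j)" for n
  define \<kappa> where "\<kappa> n = (real J - c) / (real J * s n - q n)" for n
  note lims = truncation_limits[OF x(2) xJ, folded s_def q_def]
  have "(\<lambda>n. \<bar>1 - \<kappa> n\<bar> + (1 - s n)) \<longlonglongrightarrow> \<bar>1 - (real J - c) / (real J - x)\<bar> + (1 - 1)"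
    unfolding \<kappa>_def by (intro tendsto_intros lims)
  moreover have "\<bar>1 - (real J - c) / (real J - x)\<bar> < \<delta>"
  proof -
    have "1 - (real J - c) / (real J - x) = (c - x) / (real J - x)" using xJ by (simp add: field_simps)
    moreover have "(c - x) / (real J - x) < \<delta>" using J(2) xJ \<delta> by (simp add: field_simps)
    ultimately show ?thesis using x(1) xJ by simp
  qed
  ultimately have "\<forall>\<^sub>F n in sequentially. \<bar>1 - \<kappa> n\<bar> + (1 - s n) < \<delta>"
    by (intro order_tendstoD) auto
  moreover have "\<forall>\<^sub>F n in sequentially. s n > 0" using lims(1) by (intro order_tendstoD) auto
  moreover have "\<forall>\<^sub>F n in sequentially. c \<le> real n"
    using eventually_ge_at_top[of "nat \<lceil>c\<rceil>"] by eventually_elim linarith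
  ultimately have "\<forall>\<^sub>F n in sequentially. \<bar>1 - \<kappa> n\<bar> + (1 - s n) < \<delta> \<and> s n > 0 \<and> c \<le> real n"
    by eventually_elim simp
  then obtain n where n: "\<bar>1 - \<kappa> n\<bar> + (1 - s n) < \<delta>" "s n > 0" "c \<le> real n"
    using eventually_happens'[OF sequentially_bot] by blast
  obtain \<nu> where nu: "\<nu> \<in> prob_measures_mean b c" "set_pmf \<nu> \<subseteq> {b..max n J}" "real J * s n - q n > 0" "q n \<le> c * s n"
    "\<And>j. pmf \<nu> j = \<kappa> n * (if j \<le> n then pmf \<theta> j else 0)
        + (if j = J then (c * s n - q n) / (real J * s n - q n) else 0)"
    using truncated_mixture[OF th J(1) Jb n(3) s_def q_def n(2)] unfolding \<kappa>_def by blast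
  have "tv_le \<theta> \<nu> \<delta>"
    by (rule tv_le_truncated[where n = n and \<kappa> = "\<kappa> n"]) (use nu n in \<open>auto simp: s_def\<close>)
  then show ?thesis using nu(1,2) finite_subset by blast
qed

text \<open>The mean of \<theta> is already \<open>c\<close>, so for fixed \<open>J\<close> the mass
  added at \<open>J\<close> tends to 0 and the rescaling factor to 1. The entropy of the truncated
  mixture is the truncated series, rescaled and corrected at the single point \<open>J\<close>, and
  converges to \<open>h\<close>.\<close>

lemma exists_finite_support_entropy:
  assumes th: "\<theta> \<in> prob_measures_mean b c" and c: "real b < c" and \<delta>: "\<delta> > 0" and \<alpha>: "\<alpha> > 0"
    and h: "rel_entropy b \<theta> (rho b \<alpha>) = ereal h"
  shows "\<exists>\<nu>\<in>prob_measures_mean b c. finite (set_pmf \<nu>) \<and> tv_le \<theta> \<nu> \<delta> \<and>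
    rel_entropy b \<nu> (rho b \<alpha>) \<le> ereal (h + \<delta>)"
proof -
  have thle: "\<theta> \<in> prob_measures_mean_le b c" using th prob_measures_mean_subset_le[OF c] by blast
  have thb: "\<theta> \<in> prob_measures b" and x: "(\<lambda>j. pmf \<theta> j * real j) sums c"
    using th by (auto simp: prob_measures_mean_def has_mean_iff)
  obtain J :: nat where J: "c < real J" using reals_Archimedean2 by blast
  have Jb: "b \<le> J" using J(1) c by linarith
  define \<phi> where "\<phi> j y = y * ln (y / pmf (rho b \<alpha>) j)" for j y
  define s where "s n = (\<Sum>j\<le>n. pmf \<theta> j)" for n
  define q where "q n = (\<Sum>j\<le>n. pmf \<theta> j * real j)" for n
  define \<kappa> where "\<kappa> n = (real J - c) / (real J * s n - q n)" for n
  define \<epsilon> where "\<epsilon> n = (c * s n - q n) / (real J * s n - q n)" for n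
  note lims = truncation_limits[OF x J, folded s_def q_def]
  have \<kappa>_lim: "\<kappa> \<longlonglongrightarrow> 1" using lims(3)[of "real J - c"] J by (simp add: \<kappa>_def[abs_def])
  have "(\<lambda>n. (c * s n - q n) / (real J * s n - q n)) \<longlonglongrightarrow> (c * 1 - c) / (real J * 1 - c)"
    using J by (intro tendsto_intros lims) auto
  then have \<epsilon>_lim: "\<epsilon> \<longlonglongrightarrow> 0" by (simp add: \<epsilon>_def[abs_def])
  have th0: "pmf \<theta> j = 0" if "j < b" for j
    using thb that by (auto simp: prob_measures_def pmf_eq_0_set_pmf)
  have rpos: "pmf (rho b \<alpha>) j > 0" if "j \<ge> b" for j using pmf_rho_pos[OF \<alpha> that] .
  have "(\<lambda>i. ereal (\<phi> (b + i) (pmf \<theta> (b + i)))) sums ereal h"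
    using rel_entropy_sums[OF thb rho_in_prob_measures[OF \<alpha>] rpos] h by (simp add: \<phi>_def)
  then have "(\<lambda>i. \<phi> (i + b) (pmf \<theta> (i + b))) sums h"
    by (simp add: sums_def add.commute)
  then have "(\<lambda>j. \<phi> j (pmf \<theta> j)) sums h"
    by (subst (asm) sums_iff_shift) (simp add: th0 \<phi>_def)
  then have H_lim: "(\<lambda>n. \<Sum>j\<le>n. \<phi> j (pmf \<theta> j)) \<longlonglongrightarrow> h" by (simp add: sums_def_le)
  \<comment> \<open>The entropy of the mixture when \<open>J \<le> n\<close>: scaling by
    \<open>\<kappa> n\<close> adds the term with \<open>ln (\<kappa> n)\<close>, and the last two
    terms exchange the contribution of \<open>J\<close> for the one that includes
    \<open>\<epsilon> n\<close>.\<close>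
  define G where "G n = \<kappa> n * (\<Sum>j\<le>n. \<phi> j (pmf \<theta> j)) + \<kappa> n * ln (\<kappa> n) * s n
      - \<phi> J (\<kappa> n * pmf \<theta> J) + \<phi> J (\<kappa> n * pmf \<theta> J + \<epsilon> n)" for n
  have ev: "\<forall>\<^sub>F n in sequentially. s n > 0 \<and> c \<le> real n \<and> J \<le> n"
  proof -
    have "\<forall>\<^sub>F n in sequentially. s n > 0" using lims(1) by (intro order_tendstoD) auto
    moreover have "\<forall>\<^sub>F n in sequentially. J \<le> n" by (rule eventually_ge_at_top)
    ultimately show ?thesis by eventually_elim (use J in linarith)
  qed
  have mix: "\<exists>\<nu>\<in>prob_measures_mean b c. set_pmf \<nu> \<subseteq> {b..n} \<and> real J * s n - q n > 0 \<and> q n \<le> c * s n \<and>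
    (\<forall>j. pmf \<nu> j = \<kappa> n * (if j \<le> n then pmf \<theta> j else 0) + (if j = J then \<epsilon> n else 0))"
    if n: "s n > 0 \<and> c \<le> real n \<and> J \<le> n" for n
  proof -
    have mx: "max n J = n" using n by simp
    show ?thesis
      by (rule truncated_mixture[OF thle J(1) Jb _ s_def q_def, of n])
        (use n in \<open>auto simp: \<kappa>_def \<epsilon>_def mx\<close>)
  qed
  have pos: "\<kappa> n > 0" "\<epsilon> n \<ge> 0" if "s n > 0 \<and> c \<le> real n \<and> J \<le> n" for n
    using mix[OF that] J by (auto simp: \<kappa>_def \<epsilon>_def)
  have "\<forall>\<^sub>F n in sequentially. 0 \<le> \<kappa> n * pmf \<theta> J"
    using ev by eventually_elim (use pos in \<open>simp add: less_imp_le\<close>)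
  then have \<phi>1: "(\<lambda>n. \<phi> J (\<kappa> n * pmf \<theta> J)) \<longlonglongrightarrow> \<phi> J (1 * pmf \<theta> J)"
    unfolding \<phi>_def by (intro tendsto_mult_ln_div rpos Jb tendsto_mult \<kappa>_lim tendsto_const) auto
  have "\<forall>\<^sub>F n in sequentially. 0 \<le> \<kappa> n * pmf \<theta> J + \<epsilon> n"
    using ev by eventually_elim (use pos in \<open>simp add: less_imp_le\<close>)
  then have \<phi>2: "(\<lambda>n. \<phi> J (\<kappa> n * pmf \<theta> J + \<epsilon> n)) \<longlonglongrightarrow> \<phi> J (1 * pmf \<theta> J + 0)"
    unfolding \<phi>_def
    by (intro tendsto_mult_ln_div rpos Jb tendsto_add tendsto_mult \<kappa>_lim \<epsilon>_lim tendsto_const) auto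
  have "G \<longlonglongrightarrow> 1 * h + 1 * ln 1 * 1 - \<phi> J (1 * pmf \<theta> J) + \<phi> J (1 * pmf \<theta> J + 0)"
    unfolding G_def[abs_def] by (intro tendsto_intros \<kappa>_lim lims(1) H_lim \<phi>1 \<phi>2) auto
  then have "G \<longlonglongrightarrow> h" by simp
  then have "\<forall>\<^sub>F n in sequentially. G n < h + \<delta>" using \<delta> by (intro order_tendstoD) auto
  moreover have "(\<lambda>n. \<bar>1 - \<kappa> n\<bar> + (1 - s n)) \<longlonglongrightarrow> \<bar>1 - 1\<bar> + (1 - 1)"
    by (intro tendsto_intros \<kappa>_lim lims(1))
  then have "\<forall>\<^sub>F n in sequentially. \<bar>1 - \<kappa> n\<bar> + (1 - s n) < \<delta>"
    using \<delta> by (intro order_tendstoD) auto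
  ultimately have "\<forall>\<^sub>F n in sequentially. G n < h + \<delta> \<and> \<bar>1 - \<kappa> n\<bar> + (1 - s n) < \<delta> \<and>
      s n > 0 \<and> c \<le> real n \<and> J \<le> n"
    using ev by eventually_elim simp
  then obtain n where n: "G n < h + \<delta>" "\<bar>1 - \<kappa> n\<bar> + (1 - s n) < \<delta>" "s n > 0 \<and> c \<le> real n \<and> J \<le> n"
    using eventually_happens'[OF sequentially_bot] by blast
  obtain \<nu> where nu: "\<nu> \<in> prob_measures_mean b c" "set_pmf \<nu> \<subseteq> {b..n}"
    "\<And>j. pmf \<nu> j = \<kappa> n * (if j \<le> n then pmf \<theta> j else 0) + (if j = J then \<epsilon> n else 0)"
    using mix[OF n(3)] by blast
  have tv: "tv_le \<theta> \<nu> \<delta>"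
    by (rule tv_le_truncated[where n = n and \<kappa> = "\<kappa> n"]) (use nu n pos(2)[OF n(3)] in \<open>auto simp: s_def\<close>)
  \<comment> \<open>Where \<theta> has mass the logarithm of the product splits; elsewhere both
    sides vanish.\<close>
  have scale: "\<phi> j (\<kappa> n * pmf \<theta> j) = \<kappa> n * \<phi> j (pmf \<theta> j) + \<kappa> n * ln (\<kappa> n) * pmf \<theta> j" for j
  proof (cases "pmf \<theta> j = 0")
    case False
    then have "b \<le> j" using th0 by (meson not_le)
    then have "ln (\<kappa> n * pmf \<theta> j / pmf (rho b \<alpha>) j) = ln (\<kappa> n) + ln (pmf \<theta> j / pmf (rho b \<alpha>) j)"
      using ln_mult_pos[of "\<kappa> n" "pmf \<theta> j / pmf (rho b \<alpha>) j"] pos(1)[OF n(3)] rpos[of j] False by (simp add: pmf_pos)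
    then show ?thesis by (simp add: \<phi>_def algebra_simps)
  qed (simp add: \<phi>_def)
  have "(\<Sum>j\<in>{b..n}. \<phi> j (pmf \<nu> j)) = (\<Sum>j\<le>n. \<phi> j (pmf \<nu> j))"
    using nu(2) by (intro sum.mono_neutral_left) (auto simp: \<phi>_def pmf_eq_0_set_pmf)
  also have "\<dots> = (\<Sum>j\<le>n. \<phi> j (\<kappa> n * pmf \<theta> j) +
      (if j = J then \<phi> J (\<kappa> n * pmf \<theta> J + \<epsilon> n) - \<phi> J (\<kappa> n * pmf \<theta> J) else 0))"
    by (intro sum.cong) (auto simp: nu(3))
  also have "\<dots> = G n"
    using n(3) by (simp add: sum.distrib scale G_def s_def flip: sum_distrib_left)
  finally have "rel_entropy b \<nu> (rho b \<alpha>) = ereal (G n)"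
    using rel_entropy_finite_support[of "{b..n}" b \<nu> "rho b \<alpha>"] nu(2) by (auto simp: \<phi>_def)
  then have "rel_entropy b \<nu> (rho b \<alpha>) \<le> ereal (h + \<delta>)" using n(1) by simp
  moreover have "finite (set_pmf \<nu>)" using nu(2) finite_subset by blast
  ultimately show ?thesis using nu(1) tv by blast
qed

section \<open>The limit\<close>

lemma prob_Theta_eq:
  assumes "Omega b N K M \<noteq> {}" "K = num_particles c N" "M = m N"
  shows "prob_Theta b c m N B =
    real (card {\<omega> \<in> Omega b N K M. Theta b N K \<omega> \<in> B}) / real (card (Omega b N K M))"
proof -
  have "finite (Omega b N K M)" using finite_configs by (simp add: Omega_def)
  then show ?thesis using assms
    by (simp add: prob_Theta_def Let_def measure_pmf_of_set Int_def conj_commute)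
qed

text \<open>One type suffices: the event contains the whole fiber of \<omega>.\<close>

lemma card_Theta_ge:
  assumes w: "\<omega> \<in> Omega b N K M" "Theta b N K \<omega> \<in> B" and N: "N > 0" and \<alpha>: "\<alpha> > 0"
    and r: "rel_entropy b (Theta b N K \<omega>) (rho b \<alpha>) \<le> ereal r"
  shows "exp (log_card_const b N K \<alpha> - real N * r - real M * (ln (real N) + 1))
    \<le> real (card {\<omega> \<in> Omega b N K M. Theta b N K \<omega> \<in> B})"
proof -
  define C where "C = type_fiber N K (type_mset N K \<omega>)"
  obtain r' where r': "rel_entropy b (Theta b N K \<omega>) (rho b \<alpha>) = ereal r'"
    "exp (log_card_const b N K \<alpha> - real N * r' - real M * (ln (real N) + 1)) \<le> real (card C)"
    using type_fiber_bounds[OF w(1) N \<alpha>] unfolding C_def by blast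
  have "real N * r' \<le> real N * r" using r r'(1) by (simp add: mult_left_mono)
  then have "exp (log_card_const b N K \<alpha> - real N * r - real M * (ln (real N) + 1)) \<le> real (card C)"
    by (intro order.trans[OF _ r'(2)]) simp
  moreover have "C \<subseteq> {\<omega> \<in> Omega b N K M. Theta b N K \<omega> \<in> B}"
    using type_fiber_Omega[OF w(1)] w(2) by (auto simp: C_def)
  then have "card C \<le> card {\<omega> \<in> Omega b N K M. Theta b N K \<omega> \<in> B}"
    using finite_configs by (intro card_mono) (auto simp: Omega_def)
  ultimately show ?thesis by linarith
qed

text \<open>The event is covered by the fibers of its types; each obeys the exponential bound, and
  the number of types gives the factor in front.\<close>

lemma card_Theta_le:
  assumes N: "N > 0" and \<alpha>: "\<alpha> > 0"
    and r: "\<And>\<omega>. \<omega> \<in> Omega b N K M \<Longrightarrow> Theta b N K \<omega> \<in> B \<Longrightarrow>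
      ereal r \<le> rel_entropy b (Theta b N K \<omega>) (rho b \<alpha>)"
  shows "real (card {\<omega> \<in> Omega b N K M. Theta b N K \<omega> \<in> B})
    \<le> real (((K + 1) * (N + 1)) ^ M) * exp (log_card_const b N K \<alpha> - real N * r)"
proof -
  define A where "A = {\<omega> \<in> Omega b N K M. Theta b N K \<omega> \<in> B}"
  define E where "E = exp (log_card_const b N K \<alpha> - real N * r)"
  have fin: "finite (Omega b N K M)" using finite_configs by (simp add: Omega_def)
  have finA: "finite A" using fin by (simp add: A_def)
  have "A \<subseteq> (\<Union>T\<in>type_mset N K ` A. type_fiber N K T)"
    by (auto simp: A_def type_fiber_def Omega_iff)
  then have "card A \<le> card (\<Union>T\<in>type_mset N K ` A. type_fiber N K T)"
    using finA finite_type_fiber by (intro card_mono) auto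
  also have "\<dots> \<le> (\<Sum>T\<in>type_mset N K ` A. card (type_fiber N K T))"
    using finA by (intro card_UN_le) auto
  finally have "real (card A) \<le> (\<Sum>T\<in>type_mset N K ` A. real (card (type_fiber N K T)))"
    by (metis of_nat_le_iff of_nat_sum)
  also have "\<dots> \<le> (\<Sum>T\<in>type_mset N K ` A. E)"
  proof (intro sum_mono, elim imageE, hypsubst)
    fix \<omega> assume w: "\<omega> \<in> A"
    then have wO: "\<omega> \<in> Omega b N K M" by (simp add: A_def)
    obtain r' where r': "rel_entropy b (Theta b N K \<omega>) (rho b \<alpha>) = ereal r'"
      "real (card (type_fiber N K (type_mset N K \<omega>))) \<le> exp (log_card_const b N K \<alpha> - real N * r')"
      using type_fiber_bounds[OF wO N \<alpha>] by blast
    have "real N * r \<le> real N * r'" using r[OF wO] w r'(1) by (simp add: A_def mult_left_mono)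
    then show "real (card (type_fiber N K (type_mset N K \<omega>))) \<le> E"
      unfolding E_def by (intro order.trans[OF r'(2)]) simp
  qed
  also have "\<dots> \<le> real (((K + 1) * (N + 1)) ^ M) * E"
  proof -
    have "card (type_mset N K ` A) \<le> card (type_mset N K ` Omega b N K M)"
      using fin by (intro card_mono) (auto simp: A_def)
    also have "\<dots> \<le> ((K + 1) * (N + 1)) ^ M" by (rule card_types_le[OF N])
    finally show ?thesis unfolding sum_constant
      by (intro mult_right_mono) (auto simp: E_def simp del: of_nat_power of_nat_mult)
  qed
  finally show ?thesis by (simp add: A_def E_def)
qed

text \<open>The hypothesis says that \<open>m N\<close> is \<open>o(sqrt N)\<close>; the logarithms
  are \<open>o(sqrt N)\<close> too, so the products are \<open>o(N)\<close>.\<close>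

lemma log_factors_negligible:
  assumes c: "c > 0" and m: "((\<lambda>N. (real (m N))\<^sup>2 / real N) \<longlongrightarrow> 0) (along c)"
  shows "((\<lambda>N. real (m N) * (ln (real N) + 1) / real N) \<longlongrightarrow> 0) (along c)"
    and "((\<lambda>N. real (m N) * ln ((c * real N + 1) * (real N + 1)) / real N) \<longlongrightarrow> 0) (along c)"
proof -
  have "((\<lambda>N. sqrt ((real (m N))\<^sup>2 / real N)) \<longlongrightarrow> sqrt 0) (along c)"
    by (intro tendsto_real_sqrt m)
  then have m': "((\<lambda>N. real (m N) / sqrt (real N)) \<longlongrightarrow> 0) (along c)"
    by (simp add: real_sqrt_divide)
  have *: "((\<lambda>N. real (m N) * g N / real N) \<longlongrightarrow> 0) (along c)"
    if "((\<lambda>N. g N / sqrt (real N)) \<longlongrightarrow> 0) sequentially" for g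
  proof -
    have "((\<lambda>N. (real (m N) / sqrt (real N)) * (g N / sqrt (real N))) \<longlongrightarrow> 0 * 0) (along c)"
      by (intro tendsto_mult m' tendsto_mono[OF along_le that])
    then show ?thesis by simp
  qed
  show "((\<lambda>N. real (m N) * (ln (real N) + 1) / real N) \<longlongrightarrow> 0) (along c)"
    by (rule *) real_asymp
  show "((\<lambda>N. real (m N) * ln ((c * real N + 1) * (real N + 1)) / real N) \<longlongrightarrow> 0) (along c)"
    by (rule *) (use c in real_asymp)
qed

text \<open>Openness in total variation relative to the measures of mean \<open>c\<close>. It covers
  Prohorov balls as well as the whole set of these measures, so one lemma bounds both numerator and
  denominator of the probability from below.\<close>

definition tv_open :: "nat \<Rightarrow> real \<Rightarrow> nat pmf set \<Rightarrow> bool" where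
  "tv_open b c A \<longleftrightarrow> A \<subseteq> prob_measures_mean b c \<and>
     (\<forall>\<mu>\<in>A. \<exists>\<delta>>0. \<forall>\<nu>\<in>prob_measures_mean b c. tv_le \<mu> \<nu> \<delta> \<longrightarrow> \<nu> \<in> A)"

lemma tv_le_trans: "tv_le \<mu> \<nu> \<delta> \<Longrightarrow> tv_le \<nu> \<xi> \<epsilon> \<Longrightarrow> tv_le \<mu> \<xi> (\<delta> + \<epsilon>)"
  unfolding tv_le_def by (smt (verit))

lemma tv_le_mono: "tv_le \<mu> \<nu> \<delta> \<Longrightarrow> \<delta> \<le> \<epsilon> \<Longrightarrow> tv_le \<mu> \<nu> \<epsilon>"
  unfolding tv_le_def by (smt (verit))

text \<open>A measure of \<open>A\<close> with entropy below \<open>h\<close> is replaced first by a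
  finitely supported one and then by a type, within the room left by openness and by the strict
  inequality.\<close>

lemma eventually_Theta_in_open:
  assumes A: "tv_open b c A" and c: "real b < c" and m_inf: "filterlim m at_top (along c)"
    and \<alpha>: "\<alpha> > 0" and h: "(INF \<mu>\<in>A. rel_entropy b \<mu> (rho b \<alpha>)) < ereal h"
  shows "\<forall>\<^sub>F N in along c. \<exists>\<omega>\<in>Omega b N (num_particles c N) (m N).
    Theta b N (num_particles c N) \<omega> \<in> A \<and>
    rel_entropy b (Theta b N (num_particles c N) \<omega>) (rho b \<alpha>) \<le> ereal h"
proof -
  obtain \<mu> where mu: "\<mu> \<in> A" "rel_entropy b \<mu> (rho b \<alpha>) < ereal h"
    using h by (auto simp: INF_less_iff)
  have muP: "\<mu> \<in> prob_measures_mean b c" using A mu(1) by (auto simp: tv_open_def)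
  then have "rel_entropy b \<mu> (rho b \<alpha>) \<ge> 0"
    using rel_entropy_nonneg[OF _ rho_in_prob_measures[OF \<alpha>] pmf_rho_pos[OF \<alpha>]]
    by (auto simp: prob_measures_mean_def)
  \<comment> \<open>Being nonnegative and below \<open>h\<close>, the entropy is a real
    number.\<close>
  then obtain g where g: "rel_entropy b \<mu> (rho b \<alpha>) = ereal g" "g < h"
    using mu(2) by (cases "rel_entropy b \<mu> (rho b \<alpha>)") auto
  obtain \<delta>0 where \<delta>0: "\<delta>0 > 0" "\<And>\<nu>. \<nu> \<in> prob_measures_mean b c \<Longrightarrow> tv_le \<mu> \<nu> \<delta>0 \<Longrightarrow> \<nu> \<in> A"
    using A mu(1) unfolding tv_open_def by blast
  \<comment> \<open>Two approximations follow, and each may spend half of the tolerance in total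
    variation and in entropy.\<close>
  define \<delta> where "\<delta> = min \<delta>0 (h - g) / 2"
  have \<delta>: "\<delta> > 0" "\<delta> + \<delta> \<le> \<delta>0" "g + \<delta> + \<delta> \<le> h" using \<delta>0(1) g(2) by (auto simp: \<delta>_def)
  obtain \<nu> where nu: "\<nu> \<in> prob_measures_mean b c" "finite (set_pmf \<nu>)" "tv_le \<mu> \<nu> \<delta>"
    "rel_entropy b \<nu> (rho b \<alpha>) \<le> ereal (g + \<delta>)"
    using exists_finite_support_entropy[OF muP c \<delta>(1) \<alpha> g(1)] by blast
  have "set_pmf \<nu> \<subseteq> {b..Max (set_pmf \<nu>)}"
    using nu(1,2) by (auto simp: prob_measures_mean_def prob_measures_def)
  from eventually_near_type[OF nu(1) this \<alpha> \<delta>(1) _ m_inf] c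
  have "\<forall>\<^sub>F N in along c. \<exists>\<omega>\<in>Omega b N (num_particles c N) (m N).
    tv_le \<nu> (Theta b N (num_particles c N) \<omega>) \<delta> \<and>
    rel_entropy b (Theta b N (num_particles c N) \<omega>) (rho b \<alpha>) \<le> rel_entropy b \<nu> (rho b \<alpha>) + ereal \<delta>"
    by simp
  with eventually_admissible show ?thesis
  proof eventually_elim
    case (elim N)
    then obtain \<omega> where w: "\<omega> \<in> Omega b N (num_particles c N) (m N)"
      "tv_le \<nu> (Theta b N (num_particles c N) \<omega>) \<delta>"
      "rel_entropy b (Theta b N (num_particles c N) \<omega>) (rho b \<alpha>) \<le> rel_entropy b \<nu> (rho b \<alpha>) + ereal \<delta>"
      by blast
    have "Theta b N (num_particles c N) \<omega> \<in> prob_measures_mean b c"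
      using num_particles_admissible[OF elim(1)] c elim(1)
      by (intro Theta_mean[OF w(1)]) (auto simp: admissible_def)
    moreover have "tv_le \<mu> (Theta b N (num_particles c N) \<omega>) \<delta>0"
      using tv_le_mono[OF tv_le_trans[OF nu(3) w(2)] \<delta>(2)] .
    ultimately have "Theta b N (num_particles c N) \<omega> \<in> A" by (rule \<delta>0(2))
    moreover have "rel_entropy b (Theta b N (num_particles c N) \<omega>) (rho b \<alpha>) \<le> ereal h"
    proof -
      note w(3)
      also have "rel_entropy b \<nu> (rho b \<alpha>) + ereal \<delta> \<le> ereal (g + \<delta>) + ereal \<delta>"
        by (intro add_right_mono nu(4))
      also have "\<dots> \<le> ereal h" using \<delta>(3) by simp
      finally show ?thesis .
    qed
    ultimately show ?case using w(1) by blast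
  qed
qed

text \<open>Numerator and denominator of the probability share the factor \<open>exp D\<close>,
  which cancels. Up to subexponential factors there remain \<open>exp (- N * H)\<close> and 1, the
  latter because the minimal entropy over all types tends to 0.\<close>

lemma prob_Theta_tv_open_limit:
  assumes A: "tv_open b c A" and c: "real b < c" and m_inf: "filterlim m at_top (along c)"
    and m_small: "((\<lambda>N. (real (m N))\<^sup>2 / real N) \<longlongrightarrow> 0) (along c)"
    and H: "rel_entropy_set b A (rho b (alpha b c)) = ereal H"
  shows "((\<lambda>N. eln (prob_Theta b c m N A) / ereal (real N)) \<longlongrightarrow> - ereal H) (along c)"
proof -
  define \<alpha> where "\<alpha> = alpha b c"
  have \<alpha>: "\<alpha> > 0" using alpha_pos_mean[OF c] by (simp add: \<alpha>_def)
  have c0: "c > 0" using c by linarith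
  define K where "K = num_particles c"
  define x where "x N = real (m N) * (ln (real N) + 1) / real N" for N
  define y where "y N = real (m N) * ln ((c * real N + 1) * (real N + 1)) / real N" for N
  define L where "L N = ln (prob_Theta b c m N A) / real N" for N
  have exp_le_ln: "0 < v \<and> u \<le> ln v" if "exp u \<le> v" for u v :: real
    using less_le_trans[OF exp_gt_zero that] that by (simp add: ln_ge_iff)
  \<comment> \<open>In both directions the error consists of \<open>x N\<close>, \<open>y N\<close>
    and one approximation error, each at most \<open>e / 4\<close>.\<close>
  have bounds: "\<forall>\<^sub>F N in along c. prob_Theta b c m N A > 0 \<and> L N < - H + e \<and> L N > - H - e" if e: "e > 0" for e
  proof -
    have "\<forall>\<^sub>F N in along c. y N < e / 4" unfolding y_def
      using log_factors_negligible(2)[OF c0 m_small] e by (intro order_tendstoD) auto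
    moreover have "\<forall>\<^sub>F N in along c. x N < e / 4" unfolding x_def
      using log_factors_negligible(1)[OF c0 m_small] e by (intro order_tendstoD) auto
    moreover have "\<forall>\<^sub>F N in along c. \<exists>\<omega>\<in>Omega b N (K N) (m N).
        Theta b N (K N) \<omega> \<in> A \<and> rel_entropy b (Theta b N (K N) \<omega>) (rho b \<alpha>) \<le> ereal (H + e / 4)"
      unfolding K_def using H e
      by (intro eventually_Theta_in_open[OF A c m_inf \<alpha>]) (simp add: rel_entropy_set_def \<alpha>_def)
    moreover have "\<forall>\<^sub>F N in along c. \<exists>\<omega>\<in>Omega b N (K N) (m N).
        Theta b N (K N) \<omega> \<in> prob_measures_mean b c \<and> rel_entropy b (Theta b N (K N) \<omega>) (rho b \<alpha>) \<le> ereal (e / 4)"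
    proof -
      have "tv_open b c (prob_measures_mean b c)" by (auto simp: tv_open_def intro: exI[of _ 1])
      \<comment> \<open>The tilted measure itself has mean \<open>c\<close> and entropy 0.\<close>
      moreover have "(INF \<mu>\<in>prob_measures_mean b c. rel_entropy b \<mu> (rho b \<alpha>)) < ereal (e / 4)"
        using INF_lower[OF rho_alpha_mem[OF c], of "\<lambda>\<mu>. rel_entropy b \<mu> (rho b \<alpha>)"] e
        by (simp add: \<alpha>_def rel_entropy_self order.strict_trans1)
      ultimately show ?thesis unfolding K_def using c m_inf \<alpha> by (intro eventually_Theta_in_open)
    qed
    ultimately show ?thesis using eventually_admissible
    proof eventually_elim
      case (elim N)
      define \<Omega> where "\<Omega> = Omega b N (K N) (m N)"
      define D where "D = log_card_const b N (K N) \<alpha>"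
      define num where "num = real (card {\<omega> \<in> \<Omega>. Theta b N (K N) \<omega> \<in> A})"
      define den where "den = real (card \<Omega>)"
      define Q where "Q = real (((K N + 1) * (N + 1)) ^ m N)"
      have N: "N > 0" using elim(5) by (auto simp: admissible_def)
      have KN: "real (K N) = c * real N" using num_particles_admissible[OF elim(5)] c0 by (simp add: K_def)
      have Q: "Q > 0" unfolding Q_def of_nat_0_less_iff by (rule zero_less_power) simp
      have "Q = ((c * real N + 1) * (real N + 1)) ^ m N"
        by (simp only: Q_def of_nat_power of_nat_mult of_nat_add of_nat_1 KN)
      moreover have "(c * real N + 1) * (real N + 1) > 0"
        using c0 by (intro mult_pos_pos add_nonneg_pos) auto
      ultimately have "ln Q = real (m N) * ln ((c * real N + 1) * (real N + 1))"
        by (simp only: ln_realpow)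
      then have lnQ: "ln Q = real N * y N" using N by (simp add: y_def)
      have Nx: "real (m N) * (ln (real N) + 1) = real N * x N" using N by (simp add: x_def)
      \<comment> \<open>Every number density has mean \<open>c\<close>, so the denominator counts an
        event of the same form as the numerator.\<close>
      have all: "{\<omega> \<in> \<Omega>. Theta b N (K N) \<omega> \<in> prob_measures_mean b c} = \<Omega>"
        using Theta_mean[OF _ N KN] by (auto simp: \<Omega>_def)
      have ge0: "ereal 0 \<le> rel_entropy b (Theta b N (K N) \<omega>) (rho b \<alpha>)" if "\<omega> \<in> \<Omega>" for \<omega>
        using Theta_mean[OF that[unfolded \<Omega>_def] N KN]
          rel_entropy_nonneg[OF _ rho_in_prob_measures[OF \<alpha>] pmf_rho_pos[OF \<alpha>]]
        by (auto simp: prob_measures_mean_def simp flip: zero_ereal_def)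
      have "exp (D - real N * (H + e / 4) - real N * x N) \<le> num"
        using elim(3) card_Theta_ge[OF _ _ N \<alpha>] unfolding num_def D_def \<Omega>_def Nx[symmetric] by blast
      then have num: "num > 0" "D - real N * (H + e / 4) - real N * x N \<le> ln num"
        using exp_le_ln by blast+
      have den_eq: "den = real (card {\<omega> \<in> \<Omega>. Theta b N (K N) \<omega> \<in> prob_measures_mean b c})"
        by (simp only: den_def all)
      have "exp (D - real N * (e / 4) - real N * x N) \<le> den"
        using elim(4) card_Theta_ge[OF _ _ N \<alpha>]
        unfolding den_eq D_def \<Omega>_def Nx[symmetric] by blast
      then have den: "den > 0" "D - real N * (e / 4) - real N * x N \<le> ln den"
        using exp_le_ln by blast+
      have "num \<le> Q * exp (D - real N * H)"
        unfolding num_def Q_def D_def \<Omega>_def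
      proof (rule card_Theta_le[OF N \<alpha>])
        fix \<omega> assume "Theta b N (K N) \<omega> \<in> A"
        then show "ereal H \<le> rel_entropy b (Theta b N (K N) \<omega>) (rho b \<alpha>)"
          unfolding H[symmetric] rel_entropy_set_def \<alpha>_def by (rule INF_lower)
      qed
      then have "ln num \<le> ln (Q * exp (D - real N * H))" using num Q by simp
      then have num_le: "ln num \<le> real N * y N + (D - real N * H)" using Q lnQ by (simp add: ln_mult)
      have "den \<le> Q * exp (D - real N * 0)"
        unfolding den_def Q_def D_def \<Omega>_def
        using card_Theta_le[OF N \<alpha>, of b "K N" "m N" "prob_measures_mean b c" 0] ge0 all
        by (simp add: \<Omega>_def)
      then have "ln den \<le> ln (Q * exp D)" using den Q by simp
      then have den_le: "ln den \<le> real N * y N + D" using Q lnQ by (simp add: ln_mult)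
      have prob: "prob_Theta b c m N A = num / den"
        using den(1) unfolding num_def den_def \<Omega>_def
        by (intro prob_Theta_eq) (auto simp: K_def)
      have lnp: "ln (prob_Theta b c m N A) = ln num - ln den"
        using num den by (simp add: prob ln_div)
      have "ln num - ln den \<le> real N * (y N - H + e / 4 + x N)"
        using num_le den(2) by (simp add: algebra_simps)
      then have "L N \<le> y N - H + e / 4 + x N" using N by (simp add: L_def lnp field_simps)
      moreover have "real N * (- H - e / 4 - x N - y N) \<le> ln num - ln den"
        using num(2) den_le by (simp add: algebra_simps)
      then have "- H - e / 4 - x N - y N \<le> L N" using N by (simp add: L_def lnp field_simps)
      ultimately show ?case using elim(1,2) num den e by (simp add: prob)
    qed
  qed
  have L_lim: "(L \<longlongrightarrow> - H) (along c)"
  proof (rule tendstoI)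
    fix e :: real assume "e > 0"
    from bounds[OF this] show "\<forall>\<^sub>F N in along c. dist (L N) (- H) < e"
      by eventually_elim (auto simp: dist_real_def abs_less_iff)
  qed
  \<comment> \<open>Eventually the probability is positive, so \<open>eln\<close> is the real
    logarithm and the quotient is a real number.\<close>
  have "\<forall>\<^sub>F N in along c. ereal (L N) = eln (prob_Theta b c m N A) / ereal (real N)"
    using bounds[OF zero_less_one] eventually_admissible
    by eventually_elim (simp add: eln_def L_def admissible_def)
  moreover have "((\<lambda>N. ereal (L N)) \<longlongrightarrow> - ereal H) (along c)"
    using tendsto_ereal[OF L_lim] by simp
  ultimately show ?thesis by (rule Lim_transform_eventually[rotated])
qed

theorem theorem4p1:
  fixes b :: nat and c :: real and m :: "nat \<Rightarrow> nat"
  assumes c_rat: "c \<in> \<rat>" and c_gt: "real b < c"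
    and m_bounds: "\<And>N. N \<in> admissible c \<Longrightarrow> 2 \<le> m N \<and> m N \<le> N"
    and m_inf: "filterlim m at_top (along c)"
    and m_small: "((\<lambda>N. (real (m N))\<^sup>2 / real N) \<longlongrightarrow> 0) (along c)"
  shows
    "(\<forall>\<theta>\<in>prob_measures_mean b c. \<forall>r>0.
        \<bar>rel_entropy_set b (ball_mean b c \<theta> r) (rho b (alpha b c))\<bar> \<noteq> \<infinity> \<and>
        ((\<lambda>N. eln (prob_Theta b c m N (ball_mean b c \<theta> r)) / ereal (real N)) \<longlongrightarrow>
           - rel_entropy_set b (ball_mean b c \<theta> r) (rho b (alpha b c))) (along c)) \<and>
     (\<forall>\<theta>\<in>prob_measures_mean_le b c. \<forall>r>0.
        ball_mean_le b c \<theta> r \<inter> prob_measures_mean b c \<noteq> {} \<and>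
        \<bar>rel_entropy_set b (ball_mean_le b c \<theta> r \<inter> prob_measures_mean b c) (rho b (alpha b c))\<bar> \<noteq> \<infinity> \<and>
        ((\<lambda>N. eln (prob_Theta b c m N (ball_mean_le b c \<theta> r \<inter> prob_measures_mean b c)) / ereal (real N)) \<longlongrightarrow>
           - rel_entropy_set b (ball_mean_le b c \<theta> r \<inter> prob_measures_mean b c) (rho b (alpha b c))) (along c))"
proof -
  define \<rho> where "\<rho> = rho b (alpha b c)"
  have sub: "prob_measures_mean b c \<subseteq> prob_measures_mean_le b c"
    by (rule prob_measures_mean_subset_le[OF c_gt])
  \<comment> \<open>Both parts thus concern the same kind of set, except that in (b) the centre may
    have mean below \<open>c\<close>; hence \<open>main\<close> treats all centres in
    \<open>prob_measures_mean_le b c\<close>.\<close>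
  have ball_eq: "ball_mean_le b c \<theta> r \<inter> prob_measures_mean b c = ball_mean b c \<theta> r" for \<theta> r
    using sub by (auto simp: ball_mean_le_def ball_mean_def)
  have main: "ball_mean b c \<theta> r \<noteq> {} \<and> \<bar>rel_entropy_set b (ball_mean b c \<theta> r) \<rho>\<bar> \<noteq> \<infinity> \<and>
      ((\<lambda>N. eln (prob_Theta b c m N (ball_mean b c \<theta> r)) / ereal (real N)) \<longlongrightarrow>
           - rel_entropy_set b (ball_mean b c \<theta> r) \<rho>) (along c)" (is "?P \<theta> r")
    if th: "\<theta> \<in> prob_measures_mean_le b c" and r: "r > 0" for \<theta> r
  proof -
    define A where "A = ball_mean b c \<theta> r"
    obtain \<delta> where \<delta>: "\<delta> > 0" "\<And>\<nu>. tv_le \<theta> \<nu> \<delta> \<Longrightarrow> prohorov b \<theta> \<nu> < r"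
      using prohorov_tv_open[OF prohorov_self_less[OF r]] by blast
    \<comment> \<open>A finitely supported measure in the ball shows at once that the ball is
      nonempty and that its entropy is finite.\<close>
    obtain \<nu> where nu: "\<nu> \<in> prob_measures_mean b c" "finite (set_pmf \<nu>)" "tv_le \<theta> \<nu> \<delta>"
      using exists_finite_support_near[OF th c_gt \<delta>(1)] by blast
    have nuA: "\<nu> \<in> A" using nu \<delta>(2) by (simp add: A_def ball_mean_def)
    have "rel_entropy_set b A \<rho> \<le> rel_entropy b \<nu> \<rho>"
      unfolding rel_entropy_set_def by (rule INF_lower[OF nuA])
    moreover have "rel_entropy b \<nu> \<rho> < \<infinity>"
      using rel_entropy_finite_support[OF nu(2) _ subset_refl, of b \<rho>] nu(1)
      by (simp add: prob_measures_mean_def prob_measures_def)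
    moreover have "rel_entropy_set b A \<rho> \<ge> 0"
      unfolding rel_entropy_set_def \<rho>_def using alpha_pos_mean(1)[OF c_gt]
      by (intro INF_greatest rel_entropy_nonneg rho_in_prob_measures pmf_rho_pos)
        (auto simp: A_def ball_mean_def prob_measures_mean_def)
    ultimately have fin: "\<bar>rel_entropy_set b A \<rho>\<bar> \<noteq> \<infinity>" by auto
    then obtain H where H: "rel_entropy_set b A \<rho> = ereal H" by auto
    have "tv_open b c A"
      unfolding tv_open_def
    proof (intro conjI ballI)
      fix \<mu> assume "\<mu> \<in> A"
      then obtain \<delta> where "\<delta> > 0" "\<And>\<nu>. tv_le \<mu> \<nu> \<delta> \<Longrightarrow> prohorov b \<theta> \<nu> < r"
        using prohorov_tv_open[of b \<theta> \<mu> r] by (auto simp: A_def ball_mean_def)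
      then show "\<exists>\<delta>>0. \<forall>\<nu>\<in>prob_measures_mean b c. tv_le \<mu> \<nu> \<delta> \<longrightarrow> \<nu> \<in> A"
        by (auto simp: A_def ball_mean_def)
    qed (auto simp: A_def ball_mean_def)
    from prob_Theta_tv_open_limit[OF this c_gt m_inf m_small H[unfolded \<rho>_def]] fin nuA
    show ?thesis unfolding A_def[symmetric] H by blast
  qed
  show ?thesis
    unfolding ball_eq \<rho>_def[symmetric]
  proof (intro conjI ballI allI impI)
    fix \<theta> and r :: real assume "\<theta> \<in> prob_measures_mean b c" "r > 0"
    then have m: "?P \<theta> r" by (intro main subsetD[OF sub])
    show "\<bar>rel_entropy_set b (ball_mean b c \<theta> r) \<rho>\<bar> \<noteq> \<infinity>"
      using m by (elim conjE)
    show "((\<lambda>N. eln (prob_Theta b c m N (ball_mean b c \<theta> r)) / ereal (real N)) \<longlongrightarrow>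
           - rel_entropy_set b (ball_mean b c \<theta> r) \<rho>) (along c)"
      using m by (elim conjE)
  next
    fix \<theta> and r :: real assume "\<theta> \<in> prob_measures_mean_le b c" "r > 0"
    then have m: "?P \<theta> r" by (intro main)
    show "ball_mean b c \<theta> r \<noteq> {}" using m by (elim conjE)
    show "\<bar>rel_entropy_set b (ball_mean b c \<theta> r) \<rho>\<bar> \<noteq> \<infinity>"
      using m by (elim conjE)
    show "((\<lambda>N. eln (prob_Theta b c m N (ball_mean b c \<theta> r)) / ereal (real N)) \<longlongrightarrow>
           - rel_entropy_set b (ball_mean b c \<theta> r) \<rho>) (along c)"
      using m by (elim conjE)
  qed
qed

end
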